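(* Fix an integer $d>2$. There exist graphs $\widetilde{G}$ of maximum degree $d$ with $m$ vertices, for arbitrarily large $m$, such that with probability tending to $1$ as $m\to\infty$ (over a uniformly random ordering of the vertices), $T_3(\widetilde{G})$ has treewidth $\Omega(m)$ (the hidden constant may depend on $d$).
   Context: For a finite graph $G$ and an ordering $\pi$ of its vertices, $T_3(G,\pi)$ is the subgraph of $G$ induced on the vertices having at most two neighbors preceding them in $\pi$; $T_3(G)$ denotes this random subgraph for uniformly random $\pi$. *)

theory Defs
  imports "HOL-Probability.Probability" "Graph_Theory.Graph_Theory"
begin

text \<open>
  A finite simple graph is an instance of the locale \<^locale>\<open>graph\<close>: a finite, loop-free
  symmetric digraph without parallel arcs, each edge being a pair of opposite arcs. Hence
  \<^const>\<open>out_degree\<close> is the usual degree, and \<open>u \<rightarrow>\<^bsub>G\<^esub> v\<close> says that \<open>u\<close> and \<open>v\<close> are neighbours.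
\<close>

definition max_degree :: "('a, 'b) pre_digraph \<Rightarrow> nat" where
  "max_degree G = Max (out_degree G ` verts G)"

text \<open>
  The library's \<open>tree\<close> is unsuitable here: it forbids every closed arc walk without repeated
  inner vertices, including \<open>u, v, u\<close>, so that a symmetric digraph with an edge is never a
  \<open>tree\<close>. Cycles of an undirected graph have length at least 3.
\<close>

definition undirected_tree :: "('a, 'b) pre_digraph \<Rightarrow> bool" where
  "undirected_tree T \<longleftrightarrow>
     graph T \<and> Digraph_Component.connected T \<and> \<not> (\<exists>p. pre_digraph.cycle T p \<and> length p \<ge> 3)"

text \<open>
  \<^const>\<open>Digraph_Component.connected\<close> includes nonemptiness; its name is qualified because of
  the topological notion. As all graphs here are finite, it is no restriction to take
  natural numbers as the nodes of the decomposition tree.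
\<close>

definition tree_decomposition ::
    "('a, 'b) pre_digraph \<Rightarrow> (nat, nat \<times> nat) pre_digraph \<Rightarrow> (nat \<Rightarrow> 'a set) \<Rightarrow> bool" where
  "tree_decomposition G T B \<longleftrightarrow>
     undirected_tree T \<and>
     (\<Union>t\<in>verts T. B t) = verts G \<and>
     (\<forall>u v. u \<rightarrow>\<^bsub>G\<^esub> v \<longrightarrow> (\<exists>t\<in>verts T. u \<in> B t \<and> v \<in> B t)) \<and>
     (\<forall>v\<in>verts G. Digraph_Component.connected (T \<restriction> {t \<in> verts T. v \<in> B t}))"

text \<open>The truncated subtraction matters only for the empty graph, whose treewidth is 0 here.\<close>

definition decomposition_width ::
    "(nat, nat \<times> nat) pre_digraph \<Rightarrow> (nat \<Rightarrow> 'a set) \<Rightarrow> nat" where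
  "decomposition_width T B = Max ((\<lambda>t. card (B t)) ` verts T) - 1"

definition treewidth :: "('a, 'b) pre_digraph \<Rightarrow> nat" where
  "treewidth G = (LEAST w. \<exists>T B. tree_decomposition G T B \<and> w = decomposition_width T B)"

text \<open>
  An ordering of a finite set is a list enumerating it without repetition, that is, an
  element of \<^const>\<open>permutations_of_set\<close>.
\<close>

definition precedes :: "'a list \<Rightarrow> 'a \<Rightarrow> 'a \<Rightarrow> bool" where
  "precedes \<pi> u v \<longleftrightarrow> (\<exists>i j. i < j \<and> j < length \<pi> \<and> \<pi> ! i = u \<and> \<pi> ! j = v)"

definition T3 :: "('a, 'b) pre_digraph \<Rightarrow> 'a list \<Rightarrow> ('a, 'b) pre_digraph" where
  "T3 G \<pi> = G \<restriction> {v \<in> verts G. card {u \<in> verts G. u \<rightarrow>\<^bsub>G\<^esub> v \<and> precedes \<pi> u v} \<le> 2}"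

definition random_ordering :: "('a, 'b) pre_digraph \<Rightarrow> 'a list pmf" where
  "random_ordering G = pmf_of_set (permutations_of_set (verts G))"

end

theory Submission
  imports Defs
begin

text \<open>
  Take \<open>2 N\<close> binary trees of a large constant depth \<open>h\<close>, half of them on the left and half on the
  right, replace every internal node by a star with three rays, and match the leaves on the left
  with those on the right by a permutation \<open>\<phi>\<close>. Only the star centres have degree 3, so only they can
  be missing from \<open>T\<^sub>3\<close>, and a centre is missing iff it comes last in its star. The stars being
  disjoint, the centres are missing independently with probability \<open>1/4\<close>, so that the expected
  number of leaves still connected to the root of their tree is \<open>(3/2)\<^sup>h\<close>. By the second moment
  method a tree has at least half that many with probability at least \<open>1/8\<close>, and with
  overwhelming probability a positive fraction of the trees on either side is good in this sense.

  A tree decomposition of small width yields a small balanced separator of the roots of the good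
  trees on the left. A good tree avoiding the separator lies on one side of it, together with its live
  leaves; hence linearly many trees on the left have no edge to linearly many trees on the right.
  Two given sets of \<open>r\<close> good trees span \<open>r (3/2)\<^sup>h / 2\<close> live leaves each, among \<open>256 r 2\<^sup>h\<close>
  leaves per side. A random \<open>\<phi>\<close> thus fails to join them with probability at most
  \<open>exp (- r (9/8)\<^sup>h / 1024)\<close>, which beats the \<open>4\<^sup>N\<close> choices of the two sets once \<open>h\<close> is large.
\<close>

section \<open>Balanced separations from tree decompositions\<close>

lemma dominates_induce_subgraph_iff:
  "u \<rightarrow>\<^bsub>G \<restriction> K\<^esub> v \<longleftrightarrow> u \<rightarrow>\<^bsub>G\<^esub> v \<and> u \<in> K \<and> v \<in> K"
  by (auto simp: arcs_ends_conv induce_subgraph_def)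

text \<open>Membership in \<open>S\<close> is invariant along every edge in both directions, hence
  along walks in the symmetrised graph. Connectedness is used in this form below.\<close>

lemma connected_cut:
  assumes "Digraph_Component.connected H"
    and "\<And>u v. u \<rightarrow>\<^bsub>H\<^esub> v \<Longrightarrow> u \<in> S \<longleftrightarrow> v \<in> S"
    and "u \<in> verts H" "u \<in> S" "v \<in> verts H"
  shows "v \<in> S"
proof -
  have "u \<rightarrow>\<^sup>*\<^bsub>with_proj (mk_symmetric H)\<^esub> v"
    using assms by (auto simp: connected_def mk_symmetric_def elim!: strongly_connectedE)
  then have "(u, v) \<in> (arcs_ends (with_proj (mk_symmetric H)))\<^sup>*"
    by (rule reachable_rtranclI)
  then show ?thesis
  proof induct
    case (step y z)
    then have "y \<rightarrow>\<^bsub>H\<^esub> z \<or> z \<rightarrow>\<^bsub>H\<^esub> y"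
      by (auto simp: mk_symmetric_def arcs_ends_conv)
    then show ?case using assms(2) step by blast
  qed (fact assms)
qed

text \<open>If \<open>c\<close> differed from \<open>a\<close>, a path from \<open>a\<close> to
  \<open>c\<close> avoiding \<open>t\<close> would close up through \<open>t\<close> to a cycle with
  at least three edges.\<close>

lemma undirected_tree_unique_neighbour:
  assumes T: "undirected_tree T"
    and "t \<rightarrow>\<^bsub>T\<^esub> a" "t \<rightarrow>\<^bsub>T\<^esub> c" "a \<rightarrow>\<^sup>*\<^bsub>T \<restriction> (verts T - {t})\<^esub> c"
  shows "c = a"
proof (rule ccontr)
  assume "c \<noteq> a"
  interpret graph T using T by (simp add: undirected_tree_def)
  let ?H = "T \<restriction> (verts T - {t})"
  interpret H: wf_digraph ?H by (rule wellformed_induce_subgraph) 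
  obtain p where p: "H.apath a p c" using assms(4) H.reachable_apath by blast
  have "subgraph ?H T" by (intro subgraph_induce_subgraphI) auto
  then have aw: "awalk a p c"
    using p H.apath_def subgraph_awalk_imp_awalk by blast
  have vs: "awalk_verts a p = H.awalk_verts a p"
    using compatible_awalk_verts[of T ?H] by (simp add: compatible_def induce_subgraph_def)
  have dist: "distinct (awalk_verts a p)" using p vs by (simp add: H.apath_def)
  have "set (H.awalk_verts a p) \<subseteq> verts ?H"
    using p unfolding H.apath_def by (elim conjE H.awalkE)
  then have "set (awalk_verts a p) \<subseteq> verts T - {t}" using vs by simp
  then have nt: "t \<notin> set (awalk_verts a p)" by blast
  obtain e where e: "e \<in> arcs T" "tail T e = t" "head T e = a"
    using assms(2) by auto
  have "c \<rightarrow>\<^bsub>T\<^esub> t" using assms(3) by (simp add: graph_symmetric)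
  then obtain e' where e': "e' \<in> arcs T" "tail T e' = c" "head T e' = t" by auto
  have "awalk t (e # p @ [e']) t"
    using e e' aw adj_in_verts(1)[OF assms(2)]
    by (auto simp: awalk_Cons_iff awalk_append_iff awalk_Nil_iff)
  moreover have "tl (awalk_verts t (e # p @ [e'])) = awalk_verts a p @ [t]"
    using e e' aw awlast_if_cas[of a p c] by (auto simp: awalk_def awalk_verts_conv split: if_splits)
  ultimately have "pre_digraph.cycle T (e # p @ [e'])"
    using dist nt unfolding cycle_def by (intro exI[of _ t]) auto
  moreover have "p \<noteq> []" using aw \<open>c \<noteq> a\<close> by (auto simp: awalk_Nil_iff)
  then have "length (e # p @ [e']) \<ge> 3" by (cases p) auto
  ultimately show False using T unfolding undirected_tree_def by blast
qed

text \<open>The nodes whose bags contain \<open>v\<close> induce a connected subgraph; if it missed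
  \<open>t\<close>, none of its edges could leave \<open>S\<close>, as \<open>t\<close> is the only
  exit.\<close>

lemma tree_decomposition_bag_Int:
  assumes td: "tree_decomposition G T B"
    and S: "S \<subseteq> verts T" "t \<in> verts T" "\<And>s u. s \<in> S \<Longrightarrow> s \<rightarrow>\<^bsub>T\<^esub> u \<Longrightarrow> u \<in> S \<or> u = t"
  shows "(\<Union>s\<in>insert t S. B s) \<inter> (\<Union>s\<in>verts T - S. B s) \<subseteq> B t"
proof
  fix v assume v: "v \<in> (\<Union>s\<in>insert t S. B s) \<inter> (\<Union>s\<in>verts T - S. B s)"
  interpret graph T using td by (simp add: tree_decomposition_def undirected_tree_def)
  show "v \<in> B t"
  proof (rule ccontr)
    assume nt: "v \<notin> B t"
    let ?K = "{t \<in> verts T. v \<in> B t}"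
    from v nt obtain s s' where s: "s \<in> S" "v \<in> B s" and s': "s' \<in> verts T" "s' \<notin> S" "v \<in> B s'"
      by blast
    have "v \<in> verts G" using td s S unfolding tree_decomposition_def by blast
    then have "Digraph_Component.connected (T \<restriction> ?K)"
      using td by (simp add: tree_decomposition_def)
    then have "s' \<in> S"
    proof (rule connected_cut[where u = s])
      fix x y assume "x \<rightarrow>\<^bsub>T \<restriction> ?K\<^esub> y"
      then have "x \<rightarrow>\<^bsub>T\<^esub> y" "y \<rightarrow>\<^bsub>T\<^esub> x" "x \<noteq> t" "y \<noteq> t"
        using nt by (auto simp: dominates_induce_subgraph_iff graph_symmetric)
      then show "x \<in> S \<longleftrightarrow> y \<in> S" using S(3) by blast
    qed (use s s' S in auto)
    with s' show False by simp
  qed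
qed

text \<open>Among the sets \<open>S\<close> of tree nodes whose only exit is \<open>t\<close> and
  whose bags together with \<open>B t\<close> hold a quarter of \<open>W\<close>, a smallest one is
  taken. Splitting it along an edge between some \<open>a\<close> in \<open>S\<close> and
  \<open>t\<close> gives two smaller sets, each holding less than a quarter, so at least half of
  \<open>W\<close> lies in the bags outside \<open>S\<close>.\<close>

lemma tree_decomposition_balanced_separation:
  assumes td: "tree_decomposition G T B"
    and bags: "\<And>t. t \<in> verts T \<Longrightarrow> finite (B t) \<and> card (B t) \<le> r"
    and W: "finite W" "W \<subseteq> verts G"
  obtains P Q where "P \<union> Q = verts G" "finite (P \<inter> Q)" "card (P \<inter> Q) \<le> r"
    "\<And>u v. u \<rightarrow>\<^bsub>G\<^esub> v \<Longrightarrow> {u, v} \<subseteq> P \<or> {u, v} \<subseteq> Q"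
    "card W \<le> 4 * card (W \<inter> P)" "card W \<le> 2 * card (W \<inter> Q)"
proof -
  have T: "undirected_tree T" using td by (simp add: tree_decomposition_def)
  interpret graph T using T by (simp add: undirected_tree_def)
  have V: "(\<Union>t\<in>verts T. B t) = verts G" using td by (simp add: tree_decomposition_def)
  define part where "part = (\<lambda>(S, t). \<Union>s\<in>insert t S. B s)"
  define cl where "cl = (\<lambda>(S, t). S \<subseteq> verts T \<and> t \<in> verts T \<and> t \<notin> S \<and>
    (\<forall>s\<in>S. \<forall>u. s \<rightarrow>\<^bsub>T\<^esub> u \<longrightarrow> u \<in> S \<or> u = t))"
  have clI: "cl (S, t)" if "S \<subseteq> verts T" "t \<in> verts T" "t \<notin> S"
    "\<And>s u. s \<in> S \<Longrightarrow> s \<rightarrow>\<^bsub>T\<^esub> u \<Longrightarrow> u \<in> S \<or> u = t" for S t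
    using that unfolding cl_def by auto
  define heavy where "heavy = (\<lambda>St. cl St \<and> card W \<le> 4 * card (W \<inter> part St))"
  have "verts T \<noteq> {}"
    using T by (auto simp: undirected_tree_def connected_def strongly_connected_def mk_symmetric_def)
  then obtain t0 where t0: "t0 \<in> verts T" by blast
  \<comment> \<open>The whole tree with any base is a candidate, so a minimum exists.\<close>
  have "part (verts T - {t0}, t0) = verts G" using V t0 by (auto simp: part_def)
  then have "heavy (verts T - {t0}, t0)"
    using t0 W adj_in_verts by (auto simp: heavy_def cl_def Int_absorb2)
  then obtain x where "heavy x" "\<And>y. heavy y \<Longrightarrow> card (fst x) \<le> card (fst y)"
    using ex_has_least_nat[of heavy _ "\<lambda>x. card (fst x)"] by blast
  then obtain S t where St: "heavy (S, t)"
    and least: "\<And>S' t'. heavy (S', t') \<Longrightarrow> card S \<le> card S'"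
    by (metis fst_conv prod.collapse)
  then have cl: "S \<subseteq> verts T" "t \<in> verts T" "t \<notin> S"
    "\<And>s u. s \<in> S \<Longrightarrow> s \<rightarrow>\<^bsub>T\<^esub> u \<Longrightarrow> u \<in> S \<or> u = t"
    by (auto simp: heavy_def cl_def)
  have finS: "finite S" using cl(1) finite_verts finite_subset by blast
  have light: "4 * card (W \<inter> part (S', t')) < card W" if "S' \<subset> S" "cl (S', t')" for S' t'
    using that least[of S' t'] psubset_card_mono[OF finS that(1)] by (force simp: heavy_def)
  have half: "2 * card (W \<inter> (\<Union>s\<in>S. B s)) \<le> card W"
  proof (cases "S = {}")
    case False
    then obtain s0 where s0: "s0 \<in> S" by blast
    have "\<exists>a\<in>S. a \<rightarrow>\<^bsub>T\<^esub> t"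
    proof (rule ccontr)
      assume none: "\<not> (\<exists>a\<in>S. a \<rightarrow>\<^bsub>T\<^esub> t)"
      have "t \<in> S"
      proof (rule connected_cut[where u = s0])
        show "Digraph_Component.connected T" using T by (simp add: undirected_tree_def)
        fix x y assume "x \<rightarrow>\<^bsub>T\<^esub> y"
        moreover from this have "y \<rightarrow>\<^bsub>T\<^esub> x" by (rule graph_symmetric)
        ultimately show "x \<in> S \<longleftrightarrow> y \<in> S" using cl(4) none by blast
      qed (use s0 cl in auto)
      with cl show False by simp
    qed
    then obtain a where a: "a \<in> S" "a \<rightarrow>\<^bsub>T\<^esub> t" by blast
    then have ta: "t \<rightarrow>\<^bsub>T\<^esub> a" by (simp add: graph_symmetric)
    let ?H = "T \<restriction> (verts T - {t})"
    interpret H: wf_digraph ?H by (rule wellformed_induce_subgraph)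
    \<comment> \<open>\<open>C\<close> is the branch at \<open>a\<close> of the tree with
      \<open>t\<close> removed. The set \<open>S\<close> splits into \<open>C\<close>, with new base
      \<open>a\<close>, and \<open>S - C\<close>, still with base \<open>t\<close>.\<close>
    define C where "C = {c. a \<rightarrow>\<^sup>*\<^bsub>?H\<^esub> c}"
    have aC: "a \<in> C" using a cl by (auto simp: C_def)
    have C_step: "v \<in> C" if "u \<in> C" "u \<rightarrow>\<^bsub>T\<^esub> v" "v \<noteq> t" for u v
    proof -
      have "u \<in> verts ?H" using that(1) by (auto simp: C_def dest: H.reachable_in_verts)
      then have "u \<rightarrow>\<^bsub>?H\<^esub> v"
        using that adj_in_verts by (auto simp: dominates_induce_subgraph_iff)
      then show ?thesis using that(1) H.reachable_adj_trans by (auto simp: C_def)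
    qed
    have CS: "C \<subseteq> S"
    proof
      fix c assume "c \<in> C"
      then have "a \<rightarrow>\<^sup>*\<^bsub>?H\<^esub> c" by (simp add: C_def)
      then show "c \<in> S"
      proof (induct rule: H.reachable_induct)
        case (step x y)
        then show ?case using cl(4)[of x y] by (auto simp: dominates_induce_subgraph_iff)
      qed (use a in simp)
    qed
    \<comment> \<open>Acyclicity enters here: \<open>a\<close> is the only neighbour of
      \<open>t\<close> in \<open>C\<close>, so the only exit of \<open>C - {a}\<close> is
      \<open>a\<close>.\<close>
    have only_a: "u = a" if "u \<in> C" "u \<rightarrow>\<^bsub>T\<^esub> t" for u
      using undirected_tree_unique_neighbour[OF T ta, of u] that graph_symmetric
      by (auto simp: C_def)
    have "cl (C - {a}, a)"
    proof (rule clI)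
      fix s u assume s: "s \<in> C - {a}" and su: "s \<rightarrow>\<^bsub>T\<^esub> u"
      then have "u \<noteq> t" using only_a by blast
      then have "u \<in> C" using C_step s su by blast
      then show "u \<in> C - {a} \<or> u = a" by blast
    qed (use CS cl a in auto)
    then have l1: "4 * card (W \<inter> part (C - {a}, a)) < card W"
      using aC CS by (intro light) auto
    have "cl (S - C, t)"
    proof (rule clI)
      fix s u assume s: "s \<in> S - C" and su: "s \<rightarrow>\<^bsub>T\<^esub> u"
      have "s \<noteq> t" using s cl(3) by blast
      moreover have "u \<rightarrow>\<^bsub>T\<^esub> s" using su by (rule graph_symmetric)
      ultimately have "u \<notin> C" using s C_step by blast
      then show "u \<in> S - C \<or> u = t" using s su cl(4) by blast
    qed (use cl in auto)
    then have l2: "4 * card (W \<inter> part (S - C, t)) < card W"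
      using aC CS by (intro light) auto
    \<comment> \<open>The bag of \<open>a\<close> is covered by the first part, since
      \<open>part\<close> includes the bag of the base.\<close>
    have "W \<inter> (\<Union>s\<in>S. B s) \<subseteq> (W \<inter> part (C - {a}, a)) \<union> (W \<inter> part (S - C, t))"
      using CS by (auto simp: part_def)
    then have "card (W \<inter> (\<Union>s\<in>S. B s)) \<le> card (W \<inter> part (C - {a}, a)) + card (W \<inter> part (S - C, t))"
      using W(1) by (meson card_Un_le card_mono finite_Int finite_UnI order_trans)
    then show ?thesis using l1 l2 by linarith
  qed simp
  define Q where "Q = (\<Union>s\<in>verts T - S. B s)"
  have PQ: "part (S, t) \<inter> Q \<subseteq> B t"
    using tree_decomposition_bag_Int[OF td cl(1,2,4)] by (simp add: part_def Q_def)
  show thesis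
  proof
    show "part (S, t) \<union> Q = verts G" 
      using cl(1,2) unfolding V[symmetric] part_def Q_def by auto
    show "finite (part (S, t) \<inter> Q)" "card (part (S, t) \<inter> Q) \<le> r"
      using PQ bags[OF cl(2)] by (auto intro: finite_subset order_trans[OF card_mono])
    show "{u, v} \<subseteq> part (S, t) \<or> {u, v} \<subseteq> Q" if uv: "u \<rightarrow>\<^bsub>G\<^esub> v" for u v
    proof -
      obtain s where "s \<in> verts T" "u \<in> B s" "v \<in> B s"
        using td uv unfolding tree_decomposition_def by blast
      then show ?thesis by (auto simp: part_def Q_def)
    qed
    show "card W \<le> 4 * card (W \<inter> part (S, t))" using St by (simp add: heavy_def)
    have "W \<subseteq> (\<Union>t\<in>verts T. B t)" using W V by simp
    then have "W \<subseteq> (W \<inter> (\<Union>s\<in>S. B s)) \<union> (W \<inter> Q)" unfolding Q_def by blast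
    then have "card W \<le> card (W \<inter> (\<Union>s\<in>S. B s)) + card (W \<inter> Q)"
      using W(1) by (meson card_Un_le card_mono finite_Int finite_UnI order_trans)
    then show "card W \<le> 2 * card (W \<inter> Q)" using half by linarith
  qed
qed

section \<open>Separations from the treewidth\<close>

lemma undirected_tree_single:
  "undirected_tree \<lparr>verts = {x}, arcs = {}, tail = fst, head = snd\<rparr>" (is "undirected_tree ?T")
proof -
  interpret graph ?T
    by unfold_locales (auto simp: symmetric_def arcs_ends_conv sym_def)
  have "\<not> cycle p" for p by (cases p) (auto simp: cycle_def awalk_def)
  moreover have "Digraph_Component.connected ?T"
    unfolding connected_def strongly_connected_def mk_symmetric_def reachable_def by auto
  moreover have "graph ?T" by unfold_locales
  ultimately show ?thesis by (simp add: undirected_tree_def)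
qed

text \<open>The decomposition with the single bag \<open>verts G\<close> exists, so the
  \<open>LEAST\<close> in \<open>treewidth\<close> is attained rather than unspecified.\<close>

lemma treewidth_attained:
  assumes "wf_digraph G"
  obtains T B where "tree_decomposition G T B" "decomposition_width T B = treewidth G"
proof -
  define T :: "(nat, nat \<times> nat) pre_digraph" where
    "T = \<lparr>verts = {0}, arcs = {}, tail = fst, head = snd\<rparr>"
  have ind: "{t \<in> verts T. v \<in> verts G} = {0}" if "v \<in> verts G" for v
    using that by (auto simp: T_def)
  have "T \<restriction> {0} = T" by (simp add: T_def induce_subgraph_def)
  then have "tree_decomposition G T (\<lambda>_. verts G)"
    using undirected_tree_single[of 0] wf_digraph.adj_in_verts[OF assms] ind
    unfolding tree_decomposition_def by (auto simp: T_def[symmetric] undirected_tree_def) (auto simp: T_def)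
  then have "\<exists>w T B. tree_decomposition G T B \<and> w = decomposition_width T B" by blast
  then have "\<exists>T B. tree_decomposition G T B \<and> treewidth G = decomposition_width T B"
    unfolding treewidth_def by (rule LeastI_ex)
  then show thesis using that by auto
qed

text \<open>The width is the largest bag size minus one, so \<open>treewidth G < r\<close> bounds
  the bags, and hence the separator, by \<open>r\<close>.\<close>

lemma treewidth_balanced_separation:
  assumes G: "fin_digraph G" and W: "W \<subseteq> verts G" and r: "treewidth G < r"
  obtains P Q where "P \<union> Q = verts G" "card (P \<inter> Q) \<le> r"
    "\<And>u v. u \<rightarrow>\<^bsub>G\<^esub> v \<Longrightarrow> {u, v} \<subseteq> P \<or> {u, v} \<subseteq> Q"
    "card W \<le> 4 * card (W \<inter> P)" "card W \<le> 2 * card (W \<inter> Q)"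
proof -
  interpret fin_digraph G by fact
  obtain T B where td: "tree_decomposition G T B" and w: "decomposition_width T B = treewidth G"
    using treewidth_attained wf_digraph by blast
  interpret T: graph T using td by (simp add: tree_decomposition_def undirected_tree_def)
  have bags: "finite (B t) \<and> card (B t) \<le> r" if "t \<in> verts T" for t
  proof
    have "B t \<subseteq> verts G" using td that unfolding tree_decomposition_def by blast
    then show "finite (B t)" using finite_verts finite_subset by blast
    have "card (B t) \<le> Max ((\<lambda>t. card (B t)) ` verts T)" using that by auto
    then show "card (B t) \<le> r" using w r unfolding decomposition_width_def by linarith
  qed
  have "finite W" using W finite_verts finite_subset by blast
  then show thesis
    using tree_decomposition_balanced_separation[OF td bags _ W] that by metis
qed

section \<open>The last members of disjoint stars in a random ordering\<close>

lemma precedes_map_inj: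
  assumes "inj f"
  shows "precedes (map f xs) (f u) (f v) \<longleftrightarrow> precedes xs u v"
  unfolding precedes_def by (simp add: inj_eq[OF assms] cong: conj_cong)

lemma precedes_asym:
  "distinct xs \<Longrightarrow> precedes xs u v \<Longrightarrow> \<not> precedes xs v u"
  unfolding precedes_def by (metis nth_eq_iff_index_eq less_trans not_less_iff_gr_or_eq)

text \<open>\<open>st (x, j)\<close> stands for the member \<open>j\<close> of the star
  \<open>x\<close>, which has a centre and three rays; all four are treated alike here.\<close>

definition last_in :: "('i \<times> nat \<Rightarrow> 'v) \<Rightarrow> 'v list \<Rightarrow> 'i \<Rightarrow> nat \<Rightarrow> bool" where
  "last_in st \<pi> x j \<longleftrightarrow> j < 4 \<and> (\<forall>j'<4. j' \<noteq> j \<longrightarrow> precedes \<pi> (st (x, j')) (st (x, j)))"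

lemma last_in_unique:
  assumes "distinct \<pi>" "last_in st \<pi> x j" "last_in st \<pi> x j'"
  shows "j = j'"
  using assms precedes_asym unfolding last_in_def by metis

text \<open>Injectivity gives the members distinct positions, so the one with the largest position
  comes strictly last.\<close>

lemma ex_last_in:
  assumes "inj_on st (I \<times> {..<4})" "st ` (I \<times> {..<4}) \<subseteq> set \<pi>" "x \<in> I"
  shows "\<exists>j. last_in st \<pi> x j"
proof -
  have "\<forall>j\<in>{..<4}. \<exists>i. i < length \<pi> \<and> \<pi> ! i = st (x, j)"
    using assms by (force simp: in_set_conv_nth)
  then obtain p where p: "\<And>j. j < 4 \<Longrightarrow> p j < length \<pi> \<and> \<pi> ! p j = st (x, j)"
    by (metis lessThan_iff)
  have "\<exists>j<4. \<forall>j'<4. p j' \<le> p j"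
  proof -
    have "Max (p ` {..<4::nat}) \<in> p ` {..<4}" by (intro Max_in) (auto simp: lessThan_empty_iff)
    then obtain j where "j < 4" "p j = Max (p ` {..<4::nat})" by auto
    then show ?thesis by (intro exI[of _ j]) auto
  qed
  then obtain j where j: "j < 4" "\<And>j'. j' < 4 \<Longrightarrow> p j' \<le> p j" by blast
  have "precedes \<pi> (st (x, j')) (st (x, j))" if "j' < 4" "j' \<noteq> j" for j'
  proof -
    have "st (x, j') \<noteq> st (x, j)"
      using assms j that by (auto simp: inj_on_def)
    then have "p j' \<noteq> p j" using p j that by metis
    then have "p j' < p j" using j that by (simp add: le_neq_implies_less)
    then show ?thesis using p j that unfolding precedes_def by metis
  qed
  with j show ?thesis unfolding last_in_def by blast
qed

text \<open>Being \<open>undefined\<close> off \<open>I\<close> makes a labelling an element of the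
  finite set \<open>I \<rightarrow>\<^sub>E {..<4}\<close>, over which probabilities become
  counts.\<close>

definition last_label :: "('i \<times> nat \<Rightarrow> 'v) \<Rightarrow> 'i set \<Rightarrow> 'v list \<Rightarrow> 'i \<Rightarrow> nat" where
  "last_label st I \<pi> = (\<lambda>x\<in>I. THE j. last_in st \<pi> x j)"

lemma last_in_last_label:
  assumes "inj_on st (I \<times> {..<4})" "st ` (I \<times> {..<4}) \<subseteq> set \<pi>" "x \<in> I" "distinct \<pi>"
  shows "last_in st \<pi> x (last_label st I \<pi> x)"
proof -
  have "\<exists>!j. last_in st \<pi> x j"
    by (intro ex_ex1I ex_last_in[OF assms(1-3)]) (rule last_in_unique[OF assms(4)])
  then show ?thesis using assms(3) by (auto simp: last_label_def intro: theI')
qed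

lemma last_label_eq_iff:
  assumes "inj_on st (I \<times> {..<4})" "st ` (I \<times> {..<4}) \<subseteq> set \<pi>" "distinct \<pi>"
    and "L \<in> I \<rightarrow>\<^sub>E {..<4}"
  shows "last_label st I \<pi> = L \<longleftrightarrow> (\<forall>x\<in>I. last_in st \<pi> x (L x))"
proof
  assume "last_label st I \<pi> = L"
  then show "\<forall>x\<in>I. last_in st \<pi> x (L x)" using last_in_last_label[OF assms(1,2)] assms(3) by blast
next
  assume L: "\<forall>x\<in>I. last_in st \<pi> x (L x)"
  show "last_label st I \<pi> = L"
  proof (rule extensionalityI[of _ I])
    show "last_label st I \<pi> \<in> extensional I" by (simp add: last_label_def)
    show "L \<in> extensional I" using assms(4) by (simp add: PiE_def)
    show "last_label st I \<pi> x = L x" if "x \<in> I" for x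
    proof (rule last_in_unique[OF assms(3)])
      show "last_in st \<pi> x (last_label st I \<pi> x)"
        using last_in_last_label[OF assms(1,2) that assms(3)] .
      show "last_in st \<pi> x (L x)" using L that by blast
    qed
  qed
qed

text \<open>
  Exchanging in every star the positions of the members \<open>L x\<close> and \<open>L' x\<close> turns an ordering
  with labelling \<open>L\<close> into one with labelling \<open>L'\<close>.
\<close>

lemma card_last_label_le:
  assumes inj: "inj_on st (I \<times> {..<4})" and st: "st ` (I \<times> {..<4}) \<subseteq> V" and V: "finite V"
    and L: "L \<in> I \<rightarrow>\<^sub>E {..<4}" "L' \<in> I \<rightarrow>\<^sub>E {..<4}"
  shows "card {\<pi> \<in> permutations_of_set V. last_label st I \<pi> = L}
    \<le> card {\<pi> \<in> permutations_of_set V. last_label st I \<pi> = L'}"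
proof -
  define \<tau> where "\<tau> = (\<lambda>y::'a \<times> nat. (fst y, Transposition.transpose (L (fst y)) (L' (fst y)) (snd y)))"
  \<comment> \<open>The involution \<open>\<tau>\<close> of the indices is transported to the
    vertices; everything outside the stars stays fixed.\<close>
  define \<sigma> where "\<sigma> = (\<lambda>v. if v \<in> st ` (I \<times> {..<4}) then st (\<tau> (the_inv_into (I \<times> {..<4}) st v)) else v)"
  have \<tau>_in: "\<tau> y \<in> I \<times> {..<4}" if "y \<in> I \<times> {..<4}" for y
    using that L by (auto simp: \<tau>_def Transposition.transpose_def PiE_def Pi_def split: if_splits)
  have \<tau>\<tau>: "\<tau> (\<tau> y) = y" for y by (simp add: \<tau>_def)
  have \<sigma>_st: "\<sigma> (st y) = st (\<tau> y)" if "y \<in> I \<times> {..<4}" for y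
    using that inj by (simp add: \<sigma>_def the_inv_into_f_f)
  have \<sigma>\<sigma>: "\<sigma> (\<sigma> v) = v" for v
  proof (cases "v \<in> st ` (I \<times> {..<4})")
    case True
    then obtain y where "y \<in> I \<times> {..<4}" "v = st y" by blast
    then show ?thesis using \<sigma>_st \<tau>_in \<tau>\<tau> by simp
  qed (simp add: \<sigma>_def)
  have \<sigma>_inj: "inj \<sigma>" by (rule inj_on_inverseI[of _ \<sigma>]) (rule \<sigma>\<sigma>)
  have \<sigma>_V: "\<sigma> v \<in> V" if "v \<in> V" for v
  proof (cases "v \<in> st ` (I \<times> {..<4})")
    case True
    then obtain y where "y \<in> I \<times> {..<4}" "v = st y" by blast
    then show ?thesis using \<sigma>_st \<tau>_in st by (metis image_subset_iff)
  qed (use that in \<open>simp add: \<sigma>_def\<close>)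
  have im: "\<sigma> ` V = V" using \<sigma>_V \<sigma>\<sigma> by (metis image_eqI image_subsetI subsetI subset_antisym)
  show ?thesis
  proof (rule card_inj_on_le[where f = "map \<sigma>"])
    show "inj_on (map \<sigma>) {\<pi> \<in> permutations_of_set V. last_label st I \<pi> = L}"
      using \<sigma>_inj by (auto intro: inj_on_subset[of _ UNIV] simp: inj_mapI)
    show "finite {\<pi> \<in> permutations_of_set V. last_label st I \<pi> = L'}" by simp
    show "map \<sigma> ` {\<pi> \<in> permutations_of_set V. last_label st I \<pi> = L}
      \<subseteq> {\<pi> \<in> permutations_of_set V. last_label st I \<pi> = L'}"
    proof clarify
      fix \<pi> assume \<pi>: "\<pi> \<in> permutations_of_set V" "L = last_label st I \<pi>"
      then have d: "distinct \<pi>" "set \<pi> = V" by (auto simp: permutations_of_set_def)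
      have d': "distinct (map \<sigma> \<pi>)" "set (map \<sigma> \<pi>) = V"
        using d im \<sigma>_inj by (auto simp: distinct_map intro: inj_on_subset)
      have "last_in st (map \<sigma> \<pi>) x (L' x)" if x: "x \<in> I" for x
        unfolding last_in_def
      proof (intro conjI allI impI)
        have Lx: "last_in st \<pi> x (L x)"
          using \<pi>(2) last_in_last_label[OF inj _ x d(1)] st d by auto
        have lt: "L x < 4" "L' x < 4" using L x by (auto simp: PiE_def Pi_def)
        then show "L' x < 4" by simp
        fix j' :: nat assume j': "j' < 4" "j' \<noteq> L' x"
        define j where "j = Transposition.transpose (L x) (L' x) j'"
        have j: "j < 4" "j \<noteq> L x" using j' lt by (auto simp: j_def Transposition.transpose_def)
        have "precedes (map \<sigma> \<pi>) (\<sigma> (st (x, j))) (\<sigma> (st (x, L x)))"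
          using Lx j by (auto simp: precedes_map_inj[OF \<sigma>_inj] last_in_def)
        moreover have "\<sigma> (st (x, j)) = st (x, j')" "\<sigma> (st (x, L x)) = st (x, L' x)"
          using x j lt by (simp_all add: \<sigma>_st \<tau>_def j_def)
        ultimately show "precedes (map \<sigma> \<pi>) (st (x, j')) (st (x, L' x))" by simp
      qed
      then have "last_label st I (map \<sigma> \<pi>) = L'"
        using last_label_eq_iff[OF inj _ d'(1) L(2)] st d' by auto
      then show "map \<sigma> \<pi> \<in> permutations_of_set V \<and> last_label st I (map \<sigma> \<pi>) = L'"
        using d' by (auto simp: permutations_of_set_def)
    qed
  qed
qed

lemma last_label_in_PiE:
  assumes "inj_on st (I \<times> {..<4})" "st ` (I \<times> {..<4}) \<subseteq> V" "\<pi> \<in> permutations_of_set V"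
  shows "last_label st I \<pi> \<in> I \<rightarrow>\<^sub>E {..<4}"
proof -
  have "last_in st \<pi> x (last_label st I \<pi> x)" if "x \<in> I" for x
    using last_in_last_label[OF assms(1) _ that] assms(2,3) by (auto simp: permutations_of_set_def)
  then show ?thesis by (auto simp: last_in_def last_label_def)
qed

text \<open>By the exchange in both directions, every labelling comes from equally many orderings.
  The labels are therefore independent and uniform on four values.\<close>

lemma prob_last_label:
  assumes inj: "inj_on st (I \<times> {..<4})" and st: "st ` (I \<times> {..<4}) \<subseteq> V"
    and fin: "finite V" "finite I" and S: "S \<subseteq> I \<rightarrow>\<^sub>E {..<4}"
  shows "measure_pmf.prob (pmf_of_set (permutations_of_set V)) {\<pi>. last_label st I \<pi> \<in> S}
    = real (card S) / 4 ^ card I"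
proof -
  let ?P = "permutations_of_set V" and ?E = "I \<rightarrow>\<^sub>E {..<4::nat}"
  let ?F = "\<lambda>L. {\<pi> \<in> ?P. last_label st I \<pi> = L}"
  have finE: "finite ?E" using fin by (intro finite_PiE) auto
  have cardE: "card ?E = 4 ^ card I" using fin by (simp add: card_PiE)
  have "?E \<noteq> {}" by (auto simp: PiE_eq_empty_iff lessThan_empty_iff)
  then obtain L0 where L0: "L0 \<in> ?E" by blast
  define c where "c = card (?F L0)"
  have c: "card (?F L) = c" if "L \<in> ?E" for L
    unfolding c_def using card_last_label_le[OF inj st fin(1)] that L0 by (meson le_antisym)
  have count: "card {\<pi> \<in> ?P. last_label st I \<pi> \<in> A} = card A * c" if "A \<subseteq> ?E" for A
  proof -
    have "{\<pi> \<in> ?P. last_label st I \<pi> \<in> A} = (\<Union>L\<in>A. ?F L)" by blast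
    then have "card {\<pi> \<in> ?P. last_label st I \<pi> \<in> A} = (\<Sum>L\<in>A. card (?F L))"
      using finE that by (simp add: card_UN_disjoint finite_subset disjoint_iff)
    also have "\<dots> = (\<Sum>L\<in>A. c)" using that c by (intro sum.cong) auto
    finally show ?thesis by simp
  qed
  have "{\<pi> \<in> ?P. last_label st I \<pi> \<in> ?E} = ?P"
    using last_label_in_PiE[OF inj st] by blast
  then have P: "card ?P = 4 ^ card I * c" using count[of ?E] cardE by simp
  moreover have "card ?P > 0" using fin by (simp add: card_permutations_of_set)
  ultimately have "c > 0" by (metis mult_0_right neq0_conv)
  have "measure_pmf.prob (pmf_of_set ?P) {\<pi>. last_label st I \<pi> \<in> S}
      = real (card (?P \<inter> {\<pi>. last_label st I \<pi> \<in> S})) / real (card ?P)"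
    using fin by (intro measure_pmf_of_set) auto
  also have "?P \<inter> {\<pi>. last_label st I \<pi> \<in> S} = {\<pi> \<in> ?P. last_label st I \<pi> \<in> S}" by blast
  also have "real (card \<dots>) / real (card ?P) = real (card S) / 4 ^ card I"
    using \<open>c > 0\<close> by (simp add: count[OF S] P)
  finally show ?thesis .
qed

section \<open>Live leaves of randomly labelled binary trees\<close>

definition short_words :: "nat \<Rightarrow> bool list set" where
  "short_words n = {w. length w < n}"

text \<open>
  The words of length \<open>n\<close> are the leaves of the binary tree of depth \<open>n\<close>, its internal nodes
  are the shorter words; a leaf is live if all its proper prefixes have nonzero labels.
\<close>

definition live :: "nat \<Rightarrow> (bool list \<Rightarrow> nat) \<Rightarrow> bool list set" where
  "live n f = {u. length u = n \<and> (\<forall>k<n. f (take k u) \<noteq> 0)}"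

text \<open>The threshold is half of the mean \<open>(3/2) ^ n\<close> of the number of live
  leaves.\<close>

definition good :: "nat \<Rightarrow> (bool list \<Rightarrow> nat) \<Rightarrow> bool" where
  "good n f \<longleftrightarrow> (3/2) ^ n \<le> 2 * real (card (live n f))"

lemma finite_words: "finite {w::bool list. length w = n}"
  using finite_lists_length_eq[of "UNIV::bool set" n] by simp

lemma card_words: "card {w::bool list. length w = n} = 2 ^ n"
  using card_lists_length_eq[of "UNIV::bool set" n] by simp

lemma finite_short_words: "finite (short_words n)"
proof (rule finite_subset)
  show "short_words n \<subseteq> {w. set w \<subseteq> UNIV \<and> length w \<le> n}" by (auto simp: short_words_def)
qed (rule finite_lists_length_le, simp)

lemma finite_live: "finite (live n f)"
  by (rule finite_subset[OF _ finite_words[of n]]) (auto simp: live_def)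

lemma live_cong:
  "(\<And>w. w \<in> short_words n \<Longrightarrow> f w = g w) \<Longrightarrow> live n f = live n g"
  unfolding live_def short_words_def by (intro Collect_cong conj_cong refl) auto

lemma live_Suc:
  "live (Suc n) f = (if f [] = 0 then {} else
     (#) True ` live n (\<lambda>w. f (True # w)) \<union> (#) False ` live n (\<lambda>w. f (False # w)))"
proof -
  have "u \<in> live (Suc n) f \<longleftrightarrow> (\<exists>b v. u = b # v \<and> v \<in> live n (\<lambda>w. f (b # w)) \<and> f [] \<noteq> 0)" for u
    by (cases u) (auto simp: live_def All_less_Suc2)
  then show ?thesis by (auto simp: image_iff) (metis (full_types))+
qed

lemma card_live_Suc:
  "card (live (Suc n) f) = (if f [] = 0 then 0 else
     card (live n (\<lambda>w. f (True # w))) + card (live n (\<lambda>w. f (False # w))))"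
  by (simp add: live_Suc, intro impI, subst card_Un_disjoint)
    (auto simp: finite_live card_image)

section \<open>Moments of the number of live leaves\<close>

abbreviation labellings :: "nat \<Rightarrow> (bool list \<Rightarrow> nat) set" where
  "labellings n \<equiv> short_words n \<rightarrow>\<^sub>E {..<4}"

lemma finite_labellings: "finite (labellings n)"
  by (intro finite_PiE finite_short_words) auto

text \<open>The root label and the labellings of the two subtrees are chosen independently. The
  general \<open>F\<close> serves the count and both moments.\<close>

lemma sum_labellings_Suc:
  "(\<Sum>f\<in>labellings (Suc n). F (f []) (\<lambda>w. f (True # w)) (\<lambda>w. f (False # w)))
   = (\<Sum>a<4::nat. \<Sum>f1\<in>labellings n. \<Sum>f2\<in>labellings n. F a f1 f2)"
proof -
  define g where "g = (\<lambda>(a, f1, f2) w. case w of [] \<Rightarrow> a | b # v \<Rightarrow> (if b then f1 v else f2 v :: nat))"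
  have "(\<Sum>f\<in>labellings (Suc n). F (f []) (\<lambda>w. f (True # w)) (\<lambda>w. f (False # w)))
    = (\<Sum>(a, f1, f2)\<in>{..<4} \<times> labellings n \<times> labellings n. F a f1 f2)"
  proof (rule sum.reindex_bij_witness[where i = g
        and j = "\<lambda>f. (f [], \<lambda>w. f (True # w), \<lambda>w. f (False # w))"])
    fix f assume "f \<in> labellings (Suc n)"
    then show "(f [], \<lambda>w. f (True # w), \<lambda>w. f (False # w)) \<in> {..<4} \<times> labellings n \<times> labellings n"
      by (auto simp: PiE_iff short_words_def extensional_def)
    show "g (f [], \<lambda>w. f (True # w), \<lambda>w. f (False # w)) = f"
      by (auto simp: g_def fun_eq_iff split: list.split)
  next
    fix x assume "x \<in> {..<4::nat} \<times> labellings n \<times> labellings n"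
    then show "g x \<in> labellings (Suc n)"
      by (auto simp: g_def PiE_iff short_words_def extensional_def split: list.split prod.split)
  qed (auto simp: g_def)
  then show ?thesis by (simp add: sum.cartesian_product)
qed


lemma card_labellings_Suc:
  "real (card (labellings (Suc n))) = 4 * real (card (labellings n)) ^ 2"
  using sum_labellings_Suc[where F = "\<lambda>_ _ _. 1::real" and n = n] by (simp add: power2_eq_square)

text \<open>Three of the four root labels keep both subtrees, so each level multiplies the mean by
  \<open>2 * 3/4\<close>.\<close>

lemma sum_card_live:
  "(\<Sum>f\<in>labellings n. real (card (live n f))) = card (labellings n) * (3/2) ^ n"
proof (induct n)
  case 0
  show ?case by (simp add: live_def)
next
  case (Suc n)
  let ?Z = "\<lambda>f. real (card (live n f))" and ?E = "labellings n"
  have "(\<Sum>f\<in>labellings (Suc n). real (card (live (Suc n) f)))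
    = (\<Sum>a<4::nat. \<Sum>f1\<in>?E. \<Sum>f2\<in>?E. if a = 0 then 0 else ?Z f1 + ?Z f2)"
    unfolding sum_labellings_Suc[symmetric] by (intro sum.cong refl) (simp add: card_live_Suc)
  also have "\<dots> = 3 * (\<Sum>f1\<in>?E. \<Sum>f2\<in>?E. ?Z f1 + ?Z f2)"
    by (simp add: eval_nat_numeral)
  also have "\<dots> = 6 * card ?E * (\<Sum>f\<in>?E. ?Z f)"
    by (simp add: sum.distrib sum_distrib_left mult.assoc)
  finally show ?case
    unfolding Suc by (simp add: card_labellings_Suc power2_eq_square)
qed

text \<open>With mean \<open>m\<close>, a bound \<open>C * m^2\<close> turns into
  \<open>3/4 * (2 * C + 2) * m^2\<close> at the next level, where the squared mean is
  \<open>9/4 * m^2\<close>; \<open>C = 2\<close> is the value that reproduces itself.\<close>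

lemma sum_card_live_squared:
  "(\<Sum>f\<in>labellings n. (real (card (live n f)))\<^sup>2) \<le> 2 * card (labellings n) * ((3/2) ^ n)\<^sup>2"
proof (induct n)
  case 0
  show ?case by (simp add: live_def)
next
  case (Suc n)
  let ?Z = "\<lambda>f. real (card (live n f))" and ?E = "labellings n"
  let ?K = "real (card ?E)" and ?m = "(3/2) ^ n :: real"
  have "(\<Sum>f\<in>labellings (Suc n). (real (card (live (Suc n) f)))\<^sup>2)
    = (\<Sum>a<4::nat. \<Sum>f1\<in>?E. \<Sum>f2\<in>?E. if a = 0 then 0 else (?Z f1 + ?Z f2)\<^sup>2)"
    unfolding sum_labellings_Suc[symmetric] by (intro sum.cong refl) (simp add: card_live_Suc)
  also have "\<dots> = 3 * (\<Sum>f1\<in>?E. \<Sum>f2\<in>?E. (?Z f1 + ?Z f2)\<^sup>2)"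
    by (simp add: eval_nat_numeral)
  also have "(\<Sum>f1\<in>?E. \<Sum>f2\<in>?E. (?Z f1 + ?Z f2)\<^sup>2)
    = 2 * ?K * (\<Sum>f\<in>?E. (?Z f)\<^sup>2) + 2 * (\<Sum>f1\<in>?E. \<Sum>f2\<in>?E. ?Z f1 * ?Z f2)"
    by (simp add: power2_sum sum.distrib sum_distrib_left mult.assoc)
  also have "(\<Sum>f1\<in>?E. \<Sum>f2\<in>?E. ?Z f1 * ?Z f2) = (\<Sum>f\<in>?E. ?Z f)\<^sup>2"
    by (simp add: power2_eq_square sum_product)
  also have "3 * (2 * ?K * (\<Sum>f\<in>?E. (?Z f)\<^sup>2) + 2 * (\<Sum>f\<in>?E. ?Z f)\<^sup>2)
    \<le> 3 * (2 * ?K * (2 * ?K * ?m\<^sup>2) + 2 * (?K * ?m)\<^sup>2)"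
    using Suc unfolding sum_card_live by (intro mult_left_mono add_mono) auto
  also have "\<dots> = 2 * real (card (labellings (Suc n))) * ((3/2) ^ Suc n)\<^sup>2"
    by (simp add: card_labellings_Suc power2_eq_square)
  finally show ?case by simp
qed

text \<open>The Paley--Zygmund inequality for the number of live leaves.\<close>

lemma card_good_labellings:
  "card (labellings n) \<le> 8 * card {f \<in> labellings n. good n f}"
proof -
  let ?E = "labellings n" and ?Z = "\<lambda>f. real (card (live n f))"
  let ?G = "{f \<in> ?E. good n f}"
  let ?K = "real (card ?E)" and ?m = "(3/2) ^ n :: real"
  have "?E \<noteq> {}" by (auto simp: PiE_eq_empty_iff lessThan_empty_iff)
  then have K: "?K > 0" using finite_labellings[of n] by (simp add: card_gt_0_iff)
  have "?K * ?m = (\<Sum>f\<in>?E. ?Z f)" by (simp add: sum_card_live)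
  also have "\<dots> = (\<Sum>f\<in>?E - ?G. ?Z f) + (\<Sum>f\<in>?G. ?Z f)"
    by (rule sum.subset_diff) (auto simp: finite_labellings)
  \<comment> \<open>Labellings that are not good have fewer than \<open>?m / 2\<close> live leaves,
    so they account for at most half of the total.\<close>
  also have "(\<Sum>f\<in>?E - ?G. ?Z f) \<le> (\<Sum>f\<in>?E - ?G. ?m / 2)"
    by (intro sum_mono) (auto simp: good_def)
  also have "(\<Sum>f\<in>?E - ?G. ?m / 2) \<le> ?K * (?m / 2)"
    using finite_labellings[of n] by (simp add: card_mono mult_right_mono)
  finally have "?K * ?m / 2 \<le> (\<Sum>f\<in>?G. ?Z f)" by (simp add: field_simps)
  then have "(?K * ?m / 2)\<^sup>2 \<le> (\<Sum>f\<in>?G. ?Z f)\<^sup>2" by (intro power_mono) auto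
  \<comment> \<open>Cauchy--Schwarz. The final factor 8 combines the square of the lost factor 2
    with the constant 2 of the second moment.\<close>
  also have "\<dots> \<le> (\<Sum>f\<in>?G. (?Z f)\<^sup>2) * card ?G"
    by (rule sum_squared_le_sum_of_squares)
  also have "\<dots> \<le> (\<Sum>f\<in>?E. (?Z f)\<^sup>2) * card ?G"
    using finite_labellings[of n] by (intro mult_right_mono sum_mono2) auto
  also have "\<dots> \<le> (2 * ?K * ?m\<^sup>2) * card ?G"
    using sum_card_live_squared[of n] by (intro mult_right_mono) auto
  finally have "?K * ?m\<^sup>2 * ?K \<le> ?K * ?m\<^sup>2 * (8 * card ?G)"
    by (simp add: power2_eq_square field_simps)
  moreover have "?K * ?m\<^sup>2 > 0" using K by simp
  ultimately have "?K \<le> 8 * card ?G" using mult_le_cancel_left_pos by blast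
  then show ?thesis by linarith
qed

text \<open>Exponential moments: a hit in \<open>J0\<close> gets weight \<open>1/2\<close>, so a
  coordinate in \<open>J0\<close> has mean weight at most \<open>1 - 1/16\<close>. As
  \<open>(15/16)^32 \<le> 1/4\<close>, the product over the \<open>32 * n\<close> coordinates has
  mean at most \<open>(1/4)^n\<close>, while a function with at most \<open>n\<close> hits weighs at
  least \<open>(1/2)^n\<close>.\<close>

lemma card_few_hits:
  assumes fin: "finite J" "finite E" and J0: "J0 \<subseteq> J" "card J0 = 32 * n"
    and A: "A \<subseteq> E" "card E \<le> 8 * card A"
  shows "real (card {F \<in> J \<rightarrow>\<^sub>E E. card {j \<in> J0. F j \<in> A} \<le> n}) \<le> card E ^ card J * (1/2) ^ n"
proof -
  define c :: "'a \<Rightarrow> 'b \<Rightarrow> real" where "c = (\<lambda>j f. if j \<in> J0 \<and> f \<in> A then 1/2 else 1)"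
  let ?D = "{F \<in> J \<rightarrow>\<^sub>E E. card {j \<in> J0. F j \<in> A} \<le> n}"
  have finP: "finite (J \<rightarrow>\<^sub>E E)" using fin by (intro finite_PiE) auto
  have finJ0: "finite J0" using fin J0 finite_subset by blast
  have prod_c: "(\<Prod>j\<in>J. c j (F j)) = (1/2) ^ card {j \<in> J0. F j \<in> A}" for F
  proof -
    have "(\<Prod>j\<in>J. c j (F j)) = (\<Prod>j\<in>{j \<in> J0. F j \<in> A}. c j (F j))"
      using fin J0 by (intro prod.mono_neutral_right) (auto simp: c_def)
    then show ?thesis by (simp add: c_def)
  qed
  have sum_c: "(\<Sum>f\<in>E. c j f) \<le> (if j \<in> J0 then 15/16 else 1) * card E" for j
  proof (cases "j \<in> J0")
    case True
    have "(\<Sum>f\<in>E. c j f) = (\<Sum>f\<in>E. 1 - (if f \<in> A then 1/2 else 0))"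
      using True by (intro sum.cong) (auto simp: c_def)
    also have "\<dots> = card E - card A / 2"
      using fin A by (simp add: sum_subtractf sum.If_cases Int_absorb1)
    also have "\<dots> \<le> 15/16 * card E" using A(2) by simp
    finally show ?thesis using True by simp
  qed (simp add: c_def)
  have "(1/2) ^ n * real (card ?D) = (\<Sum>F\<in>?D. (1/2) ^ n)" by simp
  also have "\<dots> \<le> (\<Sum>F\<in>?D. \<Prod>j\<in>J. c j (F j))"
    unfolding prod_c by (intro sum_mono power_decreasing) auto
  also have "\<dots> \<le> (\<Sum>F\<in>J \<rightarrow>\<^sub>E E. \<Prod>j\<in>J. c j (F j))"
    using finP by (intro sum_mono2) (auto intro!: prod_nonneg simp: c_def)
  also have "\<dots> = (\<Prod>j\<in>J. \<Sum>f\<in>E. c j f)"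
    using fin by (simp add: prod_sum_PiE)
  also have "\<dots> \<le> (\<Prod>j\<in>J. (if j \<in> J0 then 15/16 else 1) * real (card E))"
    using sum_c by (intro prod_mono) (auto intro!: sum_nonneg simp: c_def)
  also have "\<dots> = (15/16) ^ card J0 * card E ^ card J"
    using fin J0 by (simp add: prod.distrib prod.If_cases Int_absorb1)
  also have "(15/16 :: real) ^ card J0 \<le> (1/4) ^ n"
  proof -
    have "(15/16 :: real) ^ card J0 = ((15/16) ^ 32) ^ n" by (simp add: J0(2) power_mult)
    also have "\<dots> \<le> (1/4) ^ n" by (intro power_mono) (simp_all add: power_divide)
    finally show ?thesis .
  qed
  finally have "(1/2) ^ n * real (card ?D) \<le> (1/4) ^ n * card E ^ card J"
    by (simp add: mult_right_mono)
  also have "\<dots> = (1/2) ^ n * (card E ^ card J * (1/2) ^ n)"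
    by (simp add: power_mult_distrib[symmetric])
  finally show ?thesis by simp
qed

text \<open>Currying splits a labelling of the forest into one labelling per tree; the tail bound
  above then applies to the set of good labellings.\<close>

lemma card_few_good:
  assumes J: "finite J" "J0 \<subseteq> J" "card J0 = 32 * n"
  shows "real (card {L \<in> J \<times> short_words h \<rightarrow>\<^sub>E {..<4}. card {j \<in> J0. good h (\<lambda>w. L (j, w))} \<le> n})
    \<le> 4 ^ card (J \<times> short_words h) * (1/2) ^ n" (is "real (card ?D) \<le> _")
proof -
  let ?E = "labellings h" and ?G = "{f \<in> labellings h. good h f}"
  let ?D' = "{F \<in> J \<rightarrow>\<^sub>E ?E. card {j \<in> J0. F j \<in> ?G} \<le> n}"
  define cur where "cur = (\<lambda>L::'a \<times> bool list \<Rightarrow> nat. \<lambda>j\<in>J. \<lambda>w\<in>short_words h. L (j, w))"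
  have "card ?D \<le> card ?D'"
  proof (rule card_inj_on_le[where f = cur])
    show "inj_on cur ?D"
    proof (rule inj_onI)
      fix L L' assume L: "L \<in> ?D" "L' \<in> ?D" and eq: "cur L = cur L'"
      show "L = L'"
      proof (rule PiE_ext[where k = "J \<times> short_words h" and s = "\<lambda>_. {..<4}"])
        fix x assume "x \<in> J \<times> short_words h"
        then have "cur L (fst x) (snd x) = L x" "cur L' (fst x) (snd x) = L' x"
          by (auto simp: cur_def)
        with eq show "L x = L' x" by simp
      qed (use L in auto)
    qed
    show "cur ` ?D \<subseteq> ?D'"
    proof clarify
      fix L assume L: "L \<in> J \<times> short_words h \<rightarrow>\<^sub>E {..<4}"
        and few: "card {j \<in> J0. good h (\<lambda>w. L (j, w))} \<le> n"
      have E: "cur L \<in> J \<rightarrow>\<^sub>E ?E" using L by (auto simp: cur_def)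
      \<comment> \<open>\<open>cur\<close> restricts to the short words, and goodness depends on no
        other values.\<close>
      have "good h (cur L j) \<longleftrightarrow> good h (\<lambda>w. L (j, w))" if "j \<in> J" for j
        using that live_cong[of h "cur L j" "\<lambda>w. L (j, w)"] by (simp add: good_def cur_def)
      then have "{j \<in> J0. cur L j \<in> ?G} = {j \<in> J0. good h (\<lambda>w. L (j, w))}"
        using E J(2) by blast
      then show "cur L \<in> J \<rightarrow>\<^sub>E ?E \<and> card {j \<in> J0. cur L j \<in> ?G} \<le> n"
        using E few by simp
    qed
    show "finite ?D'"
      using J finite_labellings[of h] by (auto intro!: finite_PiE)
  qed
  then have "real (card ?D) \<le> real (card ?D')" by simp
  also have "\<dots> \<le> card ?E ^ card J * (1/2) ^ n"
    using J card_good_labellings[of h] finite_labellings[of h] by (intro card_few_hits) auto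
  also have "card ?E ^ card J = (4 ^ card (J \<times> short_words h) :: nat)"
    by (simp add: card_PiE finite_short_words card_cartesian_product power_mult[symmetric] mult.commute)
  finally show ?thesis by simp
qed

section \<open>Permutations avoiding a set\<close>

text \<open>
  Composing \<open>p\<close> with the transposition of \<open>p a\<close> and \<open>y \<in> Q\<close> shows that, among the
  permutations avoiding \<open>Q\<close> on \<open>P\<close>, the value at a further point \<open>a\<close> lies in \<open>Q\<close> with
  proportion at least \<open>card Q / card S\<close>.
\<close>

lemma card_permutes_avoiding:
  assumes S: "finite S" and P: "P \<subseteq> S" and Q: "Q \<subseteq> S"
  shows "real (card {p. p permutes S \<and> p ` P \<inter> Q = {}})
    \<le> fact (card S) * (1 - card Q / card S) ^ card P"
proof -
  have "finite P" using S P finite_subset by blast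
  then show ?thesis using P
  proof (induct P rule: finite_induct)
    case empty
    show ?case using S by (simp add: card_permutations)
  next
    case (insert a P)
    define F where "F = {p. p permutes S \<and> p ` P \<inter> Q = {}}"
    define H where "H = {p \<in> F. p a \<in> Q}"
    have finF: "finite F" by (rule finite_subset[OF _ finite_permutations[OF S]]) (auto simp: F_def)
    have "card (F \<times> Q) \<le> card (S \<times> H)"
    proof (rule card_inj_on_le[where f = "\<lambda>(p, y). (p a, Transposition.transpose (p a) y \<circ> p)"])
      show "inj_on (\<lambda>(p, y). (p a, Transposition.transpose (p a) y \<circ> p)) (F \<times> Q)"
      proof (rule inj_onI, clarify)
        fix p y p' y' assume eq: "p a = p' a"
          "Transposition.transpose (p a) y \<circ> p = Transposition.transpose (p' a) y' \<circ> p'"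
        \<comment> \<open>The image determines the pair: the composite takes the value
          \<open>y\<close> at \<open>a\<close>, and undoing the transposition then recovers
          \<open>p\<close>.\<close>
        from eq(2) have "Transposition.transpose (p a) y (p a) = Transposition.transpose (p' a) y' (p' a)"
          unfolding o_def by meson
        then have "y = y'" by simp
        moreover have "Transposition.transpose (p a) y \<circ> (Transposition.transpose (p a) y \<circ> p)
          = Transposition.transpose (p a) y \<circ> (Transposition.transpose (p a) y \<circ> p')"
          using eq \<open>y = y'\<close> by simp
        then have "p = p'" by (simp flip: o_assoc add: fun_eq_iff)
        ultimately show "p = p' \<and> y = y'" by simp
      qed
      show "(\<lambda>(p, y). (p a, Transposition.transpose (p a) y \<circ> p)) ` (F \<times> Q) \<subseteq> S \<times> H"
      proof clarify
        fix p y assume p: "p \<in> F" and y: "y \<in> Q"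
        have perm: "p permutes S" using p by (simp add: F_def)
        then have pa: "p a \<in> S" using insert.prems by (simp add: permutes_in_image)
        have "Transposition.transpose (p a) y \<circ> p permutes S"
          using perm pa y Q by (intro permutes_compose permutes_swap_id) auto
        \<comment> \<open>The transposition moves \<open>p a\<close> and \<open>y\<close> only;
          \<open>p x\<close> is neither, as it lies outside \<open>Q\<close> and \<open>p\<close> is
          injective.\<close>
        moreover have "Transposition.transpose (p a) y (p x) \<notin> Q" if x: "x \<in> P" for x
        proof -
          have "p x \<notin> Q" using p x by (auto simp: F_def)
          moreover have "p x \<noteq> p a"
            using permutes_inj[OF perm] x insert.hyps by (auto simp: inj_eq)
          ultimately show ?thesis using y by (auto simp: Transposition.transpose_def)
        qed
        ultimately show "p a \<in> S \<and> Transposition.transpose (p a) y \<circ> p \<in> H"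
          using pa y by (auto simp: H_def F_def)
      qed
      show "finite (S \<times> H)" using S finF by (auto simp: H_def)
    qed
    then have le: "card F * card Q \<le> card S * card H" by (simp add: card_cartesian_product)
    have S0: "card S > 0" using S insert.prems by (auto simp: card_gt_0_iff)
    have QS: "card Q / card S \<le> 1" using S0 card_mono[OF S Q] by simp
    have "real (card F) * card Q \<le> card S * real (card H)" using le by (simp flip: of_nat_mult)
    then have H: "card F * (card Q / card S) \<le> real (card H)"
      using S0 by (simp add: field_simps)
    have "{p. p permutes S \<and> p ` insert a P \<inter> Q = {}} = F - H"
      by (auto simp: F_def H_def)
    moreover have "H \<subseteq> F" by (auto simp: H_def)
    ultimately have "real (card {p. p permutes S \<and> p ` insert a P \<inter> Q = {}}) = real (card F) - card H"
      using finF by (simp add: card_Diff_subset finite_subset of_nat_diff card_mono)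
    also have "\<dots> \<le> card F * (1 - card Q / card S)" using H by (simp add: algebra_simps)
    also have "\<dots> \<le> fact (card S) * (1 - card Q / card S) ^ card P * (1 - card Q / card S)"
      using insert.hyps(3) insert.prems QS by (intro mult_right_mono) (auto simp: F_def)
    also have "\<dots> = fact (card S) * (1 - card Q / card S) ^ card (insert a P)"
      using insert.hyps by simp
    finally show ?case .
  qed
qed

section \<open>The graph of matched trees\<close>

lemma card_pair_le: "card {x, y} \<le> 2"
  by (simp add: card_insert_if)

lemma card_le_if_subset_pair: "A \<subseteq> {x, y} \<Longrightarrow> card A \<le> 2"
  using card_mono[of "{x, y}" A] card_pair_le[of x y] by auto

text \<open>
  A vertex \<open>((t, w), j)\<close> belongs to the node \<open>w\<close> of the tree \<open>t\<close>. The internal nodes are stars with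
  centre \<open>j = 0\<close>, port \<open>j = 1\<close> towards the parent and ports \<open>j = 2, 3\<close> towards the children; the
  leaves consist of the port \<open>j = 1\<close> only. The trees \<open>(True, i)\<close> and \<open>(False, i)\<close>, \<open>i < N\<close>, form the
  two sides of the graph, whose leaves are matched by \<open>\<phi>\<close>. The index \<open>(True, N)\<close> is used for an
  additional star with \<open>d\<close> rays, which makes the maximum degree equal to \<open>d\<close>.
\<close>

type_synonym node = "(bool \<times> nat) \<times> bool list"

locale matched_trees =
  fixes N h d :: nat and \<phi> :: "nat \<times> bool list \<Rightarrow> nat \<times> bool list"
  assumes perm: "\<phi> permutes {..<N} \<times> {u. length u = h}"
    and d: "d > 2"
begin

definition nodes :: "node set" where
  "nodes = (UNIV \<times> {..<N}) \<times> short_words h"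

definition V :: "(node \<times> nat) set" where
  "V = nodes \<times> {..<4} \<union> ((UNIV \<times> {..<N}) \<times> {u. length u = h}) \<times> {1} \<union> {((True, N), [])} \<times> {..d}"

text \<open>Each edge is listed in one direction: from a centre to its rays, from a port down to the
  child, from a leaf on the left to one on the right. This keeps case distinctions short.\<close>

inductive joined :: "node \<times> nat \<Rightarrow> node \<times> nat \<Rightarrow> bool" where
  ray: "joined (x, 0) (x, j)" if "x \<in> nodes" "j \<in> {1, 2, 3}"
| child: "joined ((t, w), if b then 2 else 3) ((t, w @ [b]), 1)" if "(t, w) \<in> nodes"
| leaf: "joined (((True, i), u), 1) (((False, i'), u'), 1)" if "i < N" "length u = h" "\<phi> (i, u) = (i', u')"
| extra: "joined (((True, N), []), 0) (((True, N), []), j)" if "1 \<le> j" "j \<le> d"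

definition adj :: "node \<times> nat \<Rightarrow> node \<times> nat \<Rightarrow> bool" where
  "adj u v \<longleftrightarrow> joined u v \<or> joined v u"

text \<open>Vertices are encoded by \<open>to_nat\<close> to fit the type in the theorem; an arc is
  the pair of its ends, which excludes parallel arcs.\<close>

definition graph_of :: "(nat, nat \<times> nat) pre_digraph" where
  "graph_of = \<lparr>verts = to_nat ` V, arcs = {(to_nat u, to_nat v) | u v. adj u v}, tail = fst, head = snd\<rparr>"

section \<open>The construction as a finite simple graph\<close>

lemma finite_nodes: "finite nodes"
  by (simp add: nodes_def finite_short_words)

lemma finite_V: "finite V"
  by (simp add: V_def finite_nodes finite_words)

lemma phi_in: "i < N \<Longrightarrow> length u = h \<Longrightarrow> \<phi> (i, u) = (i', u') \<Longrightarrow> i' < N \<and> length u' = h"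
  using permutes_in_image[OF perm, of "(i, u)"] by simp

lemma joined_in_V: "joined u v \<Longrightarrow> u \<in> V \<and> v \<in> V"
  by (induct rule: joined.induct)
    (auto simp: V_def nodes_def short_words_def dest: phi_in)

lemma adj_in_V: "adj u v \<Longrightarrow> u \<in> V \<and> v \<in> V"
  by (auto simp: adj_def dest: joined_in_V)

lemma joined_irrefl: "\<not> joined u u"
proof
  assume "joined u u"
  then show False by cases (auto split: if_splits)
qed

lemma adj_sym: "adj u v \<Longrightarrow> adj v u"
  by (auto simp: adj_def)

lemma dominates_graph_of: "a \<rightarrow>\<^bsub>graph_of\<^esub> b \<longleftrightarrow> (\<exists>u v. a = to_nat u \<and> b = to_nat v \<and> adj u v)"
  by (auto simp: graph_of_def arcs_ends_conv image_iff)

lemma verts_graph_of: "verts graph_of = to_nat ` V"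
  by (simp add: graph_of_def)

lemma arcs_graph_ofD:
  assumes "e \<in> arcs graph_of"
  shows "fst e \<in> verts graph_of" "snd e \<in> verts graph_of" "fst e \<noteq> snd e" "(snd e, fst e) \<in> arcs graph_of"
proof -
  obtain u v where e: "e = (to_nat u, to_nat v)" "adj u v"
    using assms unfolding graph_of_def pre_digraph.simps by blast
  then show "fst e \<in> verts graph_of" "snd e \<in> verts graph_of"
    using adj_in_V[OF e(2)] by (simp_all add: graph_of_def)
  show "fst e \<noteq> snd e" using e joined_irrefl[of u] by (auto simp: adj_def)
  show "(snd e, fst e) \<in> arcs graph_of"
    unfolding graph_of_def pre_digraph.simps e(1) fst_conv snd_conv using adj_sym[OF e(2)] by blast
qed

lemma graph_graph_of: "graph graph_of"
proof unfold_locales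
  have "arcs graph_of \<subseteq> verts graph_of \<times> verts graph_of"
    using arcs_graph_ofD(1,2) by (auto simp: mem_Times_iff)
  then show "finite (arcs graph_of)"
    by (rule finite_subset) (simp add: verts_graph_of finite_V)
  have ends: "tail graph_of = fst" "head graph_of = snd" by (simp_all add: graph_of_def)
  show "symmetric graph_of"
    unfolding symmetric_conv ends
  proof
    fix e assume "e \<in> arcs graph_of"
    then show "\<exists>e'\<in>arcs graph_of. fst e = snd e' \<and> snd e = fst e'"
      by (intro bexI[of _ "(snd e, fst e)"] arcs_graph_ofD(4)) simp_all
  qed
  show "tail graph_of e \<in> verts graph_of" "head graph_of e \<in> verts graph_of"
    "tail graph_of e \<noteq> head graph_of e" if "e \<in> arcs graph_of" for e
    using arcs_graph_ofD[OF that] by (simp_all add: ends)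
  show "e = e'" if "arc_to_ends graph_of e = arc_to_ends graph_of e'" for e e'
    using that by (simp add: arc_to_ends_def ends prod_eq_iff)
qed (simp add: verts_graph_of finite_V)

section \<open>Neighbourhoods and the maximum degree\<close>

lemma not_joined_to_centre: "\<not> joined v (x, 0)"
proof
  show "joined v (x, 0) \<Longrightarrow> False" by (erule joined.cases) simp_all
qed

lemma joined_from_centre:
  "x \<in> nodes \<Longrightarrow> joined (x, 0) v \<Longrightarrow> v \<in> {(x, 1), (x, 2), (x, 3)}"
  by (erule joined.cases) (simp_all add: nodes_def split: if_splits)

lemma centre_neighbours:
  "x \<in> nodes \<Longrightarrow> adj (x, 0) v \<Longrightarrow> v \<in> {(x, 1), (x, 2), (x, 3)}"
  unfolding adj_def using not_joined_to_centre joined_from_centre by blast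

definition mate :: "(bool \<times> nat) \<Rightarrow> bool list \<Rightarrow> node \<times> nat" where
  "mate t w = (let y = (if fst t then \<phi> else inv \<phi>) (snd t, w) in (((\<not> fst t, fst y), snd y), 1))"

lemma joined_from_port:
  assumes "joined ((t, w), j) v" "j \<noteq> 0"
  shows "j = 1 \<and> length w = h \<and> v = mate t w \<or> j = 2 \<and> v = ((t, w @ [True]), 1) \<or> j = 3 \<and> v = ((t, w @ [False]), 1)"
  using assms(1)
proof cases
  case leaf
  then show ?thesis by (simp add: mate_def)
qed (use assms(2) in \<open>simp_all split: if_splits\<close>)

lemma joined_to_port:
  assumes "joined v ((t, w), j)" "snd t < N"
  shows "v = ((t, w), 0) \<and> (t, w) \<in> nodes \<or> j = 1 \<and> (v = ((t, butlast w), if last w then 2 else 3) \<or> length w = h \<and> v = mate t w)"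
  using assms(1)
proof cases
  case (leaf i u i')
  then have "inv \<phi> (i', w) = (i, u)" using permutes_inverses(2)[OF perm] by metis
  then show ?thesis using leaf phi_in[OF leaf(4-6)] by (simp add: mate_def)
next
  case extra
  then show ?thesis using assms(2) by simp
qed simp_all

text \<open>A port is adjacent to its centre, or to its mate if it is a leaf, and besides to at most
  one port of the parent or of a child.\<close>

lemma card_port_neighbours:
  assumes "((t, w), j) \<in> V" "snd t < N" "j \<noteq> 0"
  shows "card {v. adj ((t, w), j) v} \<le> 2"
proof -
  have nodes: "length w < h" if "(t, w) \<in> nodes" using that by (auto simp: nodes_def short_words_def)
  define a where "a = (if j = 1 \<and> length w = h then mate t w else ((t, w), 0))"
  \<comment> \<open>At a root, \<open>butlast []\<close> and \<open>last []\<close> yield a spurious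
    value, which the inclusion below tolerates.\<close>
  define b where "b = (if j = 1 then ((t, butlast w), if last w then 2 else 3)
    else ((t, w @ [j = 2]), 1 :: nat))"
  have "{v. adj ((t, w), j) v} \<subseteq> {a, b}"
  proof
    fix v assume "v \<in> {v. adj ((t, w), j) v}"
    then consider "joined ((t, w), j) v" | "joined v ((t, w), j)" unfolding adj_def by blast
    then show "v \<in> {a, b}"
    proof cases
      case 1
      from joined_from_port[OF this assms(3)] show ?thesis
        by (elim disjE conjE) (simp_all add: a_def b_def)
    next
      case 2
      from joined_to_port[OF this assms(2)] nodes show ?thesis
        by (elim disjE conjE) (simp_all add: a_def b_def)
    qed
  qed
  then show ?thesis by (rule card_le_if_subset_pair)
qed

lemma out_degree_graph_of: "out_degree graph_of (to_nat u) = card {v. adj u v}"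
proof -
  have "out_arcs graph_of (to_nat u) = (\<lambda>v. (to_nat u, to_nat v)) ` {v. adj u v}"
    unfolding out_arcs_def graph_of_def pre_digraph.simps using injD[OF inj_to_nat] by fastforce
  then show ?thesis unfolding out_degree_def by (simp add: card_image inj_on_def)
qed

text \<open>The additional centre attains \<open>d\<close>. The centres in the trees have degree at
  most 3, which is where \<open>d > 2\<close> enters, and all other vertices have degree at most
  2.\<close>

lemma max_degree_graph_of: "max_degree graph_of = d"
  unfolding max_degree_def
proof (rule Max_eqI)
  show "finite (out_degree graph_of ` verts graph_of)"
    using finite_V by (simp add: graph_of_def)
  have "{v. adj (((True, N), []), 0) v} = (\<lambda>j. (((True, N), []), j)) ` {1..d}"
    by (auto simp: adj_def nodes_def intro: joined.extra elim!: joined.cases split: if_splits)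
  then have "card {v. adj (((True, N), []), 0) v} = d"
    by (simp add: card_image inj_on_def)
  then have "out_degree graph_of (to_nat (((True, N), [] :: bool list), 0::nat)) = d"
    by (simp add: out_degree_graph_of)
  moreover have "to_nat (((True, N), [] :: bool list), 0::nat) \<in> verts graph_of"
    by (auto simp: graph_of_def V_def)
  ultimately show "d \<in> out_degree graph_of ` verts graph_of" by force
  fix y assume "y \<in> out_degree graph_of ` verts graph_of"
  then obtain u where u: "u \<in> V" "y = card {v. adj u v}"
    unfolding verts_graph_of image_image out_degree_graph_of by blast
  obtain t w j where u': "u = ((t, w), j)" by (metis prod.collapse)
  consider "snd t < N" "j \<noteq> 0" | "(t, w) \<in> nodes" "j = 0" | "t = (True, N)" "w = []" "j = 0"
    | "t = (True, N)" "w = []" "j \<noteq> 0"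
    using u u' by (force simp: V_def nodes_def)
  then show "y \<le> d"
  proof cases
    case 1
    then show ?thesis using card_port_neighbours u u' d by fastforce
  next
    case 2
    then have "{v. adj u v} \<subseteq> {((t, w), 1), ((t, w), 2), ((t, w), 3)}"
      using centre_neighbours u' by blast
    then have "card {v. adj u v} \<le> card {((t, w), 1::nat), ((t, w), 2), ((t, w), 3)}"
      by (intro card_mono) auto
    then show ?thesis using u d by simp
  next
    case 3
    then show ?thesis using u u' \<open>card {v. adj (((True, N), []), 0) v} = d\<close> by simp
  next
    case 4
    then have "{v. adj u v} \<subseteq> {(((True, N), []), 0), (((True, N), []), 0)}"
      using u' by (auto simp: adj_def nodes_def elim!: joined.cases split: if_splits)
    from card_le_if_subset_pair[OF this] show ?thesis using u(2) d by simp
  qed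
qed

section \<open>Survival in \<open>T3\<close> and the treewidth bound\<close>

lemma to_nat_nodes_subset: "to_nat ` (nodes \<times> {..<4::nat}) \<subseteq> verts graph_of"
  by (auto simp: graph_of_def V_def)

abbreviation label :: "nat list \<Rightarrow> node \<Rightarrow> nat" where
  "label \<equiv> last_label to_nat nodes"

text \<open>A port has at most two neighbours in all. A centre has three, but if its label is
  nonzero, one of them comes after it.\<close>

lemma in_T3:
  assumes \<pi>: "\<pi> \<in> permutations_of_set (verts graph_of)"
    and v: "((t, w), j) \<in> V" "snd t < N" "j = 0 \<longrightarrow> (t, w) \<in> nodes \<and> label \<pi> (t, w) \<noteq> 0"
  shows "to_nat ((t, w), j) \<in> verts (T3 graph_of \<pi>)"
proof -
  have dist: "distinct \<pi>" "set \<pi> = verts graph_of" using \<pi> by (auto simp: permutations_of_set_def)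
  define U where "U = {u. adj ((t, w), j) u \<and> precedes \<pi> (to_nat u) (to_nat ((t, w), j))}"
  have fin: "finite {u. adj ((t, w), j) u}"
    by (rule finite_subset[OF _ finite_V]) (use adj_in_V in blast)
  have "{u \<in> verts graph_of. u \<rightarrow>\<^bsub>graph_of\<^esub> to_nat ((t, w), j) \<and> precedes \<pi> u (to_nat ((t, w), j))}
      \<subseteq> to_nat ` U"
  proof
    fix a assume "a \<in> {u \<in> verts graph_of. u \<rightarrow>\<^bsub>graph_of\<^esub> to_nat ((t, w), j)
      \<and> precedes \<pi> u (to_nat ((t, w), j))}"
    then obtain u where "a = to_nat u" "adj u ((t, w), j)" "precedes \<pi> a (to_nat ((t, w), j))"
      unfolding dominates_graph_of by (auto simp del: split_paired_Ex)
    then show "a \<in> to_nat ` U" using adj_sym unfolding U_def by blast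
  qed
  moreover have "finite U" using fin by (rule finite_subset[rotated]) (auto simp: U_def)
  ultimately have "card {u \<in> verts graph_of. u \<rightarrow>\<^bsub>graph_of\<^esub> to_nat ((t, w), j)
      \<and> precedes \<pi> u (to_nat ((t, w), j))} \<le> card U"
    by (meson surj_card_le)
  also have "card U \<le> 2"
  proof (cases "j = 0")
    case False
    have "card U \<le> card {u. adj ((t, w), j) u}" using fin by (intro card_mono) (auto simp: U_def)
    then show ?thesis using card_port_neighbours[OF v(1,2) False] by linarith
  next
    case True
    then have x: "(t, w) \<in> nodes" "label \<pi> (t, w) \<noteq> 0" using v by auto
    let ?l = "label \<pi> (t, w)"
    have "last_in to_nat \<pi> (t, w) ?l"
      using x dist to_nat_nodes_subset by (intro last_in_last_label) (auto simp: inj_on_def)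
    then have l: "?l < 4" "precedes \<pi> (to_nat ((t, w), 0::nat)) (to_nat ((t, w), ?l))"
      using x by (auto simp: last_in_def)
    have U: "U \<subseteq> {((t, w), 1), ((t, w), 2), ((t, w), 3)} - {((t, w), ?l)}"
      using centre_neighbours[OF x(1)] precedes_asym[OF dist(1) l(2)] True
      unfolding U_def by blast
    consider "?l = 1" | "?l = 2" | "?l = 3" using l(1) x(2) by linarith
    then have "\<exists>a b. U \<subseteq> {a, b}"
    proof cases
      case 1
      then have "U \<subseteq> {((t, w), 2), ((t, w), 3)}" using U by auto
      then show ?thesis by blast
    next
      case 2
      then have "U \<subseteq> {((t, w), 1), ((t, w), 3)}" using U by auto
      then show ?thesis by blast
    next
      case 3
      then have "U \<subseteq> {((t, w), 1), ((t, w), 2)}" using U by auto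
      then show ?thesis by blast
    qed
    then show ?thesis by (elim exE) (rule card_le_if_subset_pair)
  qed
  finally show ?thesis using v(1) by (simp add: T3_def graph_of_def)
qed

text \<open>It depends on the ordering only through the labels, so its failure can be bounded by
  counting labellings. A small balanced separator would violate it.\<close>

definition mixing :: "nat \<Rightarrow> (node \<Rightarrow> nat) \<Rightarrow> bool" where
  "mixing r L \<longleftrightarrow> (\<forall>A B. A \<subseteq> {i. i < N \<and> good h (\<lambda>w. L ((True, i), w))} \<longrightarrow>
    B \<subseteq> {i. i < N \<and> good h (\<lambda>w. L ((False, i), w))} \<longrightarrow> r \<le> card A \<longrightarrow> r \<le> card B \<longrightarrow>
    (\<exists>i\<in>A. \<exists>i'\<in>B. \<exists>u\<in>live h (\<lambda>w. L ((True, i), w)). \<exists>u'\<in>live h (\<lambda>w. L ((False, i'), w)).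
      \<phi> (i, u) = (i', u')))"

text \<open>A separator of size at most \<open>r\<close> meets at most \<open>r\<close> trees, and a
  good tree that it misses has its root and live leaves on one side. On the left, at least
  \<open>8 * r / 4 - r = r\<close> missed good trees remain in each of \<open>P\<close> and
  \<open>Q\<close>; on the right, one of the two keeps at least \<open>8 * r / 2 - r\<close>. Mixing
  then joins two trees on opposite sides of the separation.\<close>

lemma treewidth_T3_ge:
  assumes \<pi>: "\<pi> \<in> permutations_of_set (verts graph_of)"
    and many: "\<And>s. 8 * r \<le> card {i. i < N \<and> good h (\<lambda>w. label \<pi> ((s, i), w))}"
    and mix: "mixing r (label \<pi>)"
  shows "r \<le> treewidth (T3 graph_of \<pi>)"
proof (rule ccontr)
  assume "\<not> ?thesis"
  then have tw: "treewidth (T3 graph_of \<pi>) < r" by simp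
  let ?H = "T3 graph_of \<pi>" and ?L = "label \<pi>"
  interpret G: graph graph_of by (rule graph_graph_of)
  have "wf_digraph ?H" unfolding T3_def by (rule G.wellformed_induce_subgraph)
  then interpret H: fin_digraph ?H
    by (rule wf_digraph.fin_digraphI) (auto simp: T3_def)
  define gd where "gd = (\<lambda>s. {i. i < N \<and> good h (\<lambda>w. ?L ((s, i), w))})"
  define root :: "bool \<Rightarrow> nat \<Rightarrow> nat" where "root = (\<lambda>s i. to_nat (((s, i), [] :: bool list), 1::nat))"
  have edge: "to_nat u \<rightarrow>\<^bsub>?H\<^esub> to_nat v"
    if "adj u v" "to_nat u \<in> verts ?H" "to_nat v \<in> verts ?H" for u v :: "node \<times> nat"
    using that by (auto simp: T3_def dominates_induce_subgraph_iff dominates_graph_of)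
  have root_H: "root s i \<in> verts ?H" if "i < N" for s i
    unfolding root_def using that by (intro in_T3[OF \<pi>]) (auto simp: V_def nodes_def short_words_def)
  have inj_root: "inj_on (root s) A" for s A by (auto simp: root_def inj_on_def)
  have fin_gd: "finite (gd s)" for s by (simp add: gd_def)
  have W: "root True ` gd True \<subseteq> verts ?H" using root_H by (auto simp: gd_def)
  obtain P Q where PQ: "P \<union> Q = verts ?H" "card (P \<inter> Q) \<le> r"
    "\<And>u v. u \<rightarrow>\<^bsub>?H\<^esub> v \<Longrightarrow> {u, v} \<subseteq> P \<or> {u, v} \<subseteq> Q"
    "card (root True ` gd True) \<le> 4 * card (root True ` gd True \<inter> P)"
    "card (root True ` gd True) \<le> 2 * card (root True ` gd True \<inter> Q)"
    using treewidth_balanced_separation[OF H.fin_digraph W tw] by blast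
  \<comment> \<open>Decoding the vertices in the separator gives the indices of the trees that it
    meets.\<close>
  define hit where "hit = (\<lambda>a. fst (fst (from_nat a :: node \<times> nat))) ` (P \<inter> Q)"
  have fin_PQ: "finite (P \<inter> Q)"
    by (rule finite_subset[OF _ H.finite_verts]) (use PQ(1) in auto)
  have hit_card: "card hit \<le> r" and fin_hit: "finite hit"
    using PQ(2) fin_PQ card_image_le[OF fin_PQ] by (auto simp: hit_def intro: order_trans)
  have hitI: "t \<in> hit" if "to_nat ((t, w :: bool list), j :: nat) \<in> P \<inter> Q" for t w j
  proof -
    have "fst (fst (from_nat (to_nat ((t, w), j)) :: node \<times> nat)) \<in> hit"
      unfolding hit_def using that by (rule imageI)
    then show ?thesis by simp
  qed
  \<comment> \<open>An edge lies within \<open>P\<close> or within \<open>Q\<close>, and a vertex of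
    a tree outside \<open>hit\<close> belongs to only one of them, so its surviving neighbours are
    on the same side.\<close>
  have stay: "to_nat v \<in> R"
    if "adj ((t, w), j) v" "to_nat ((t, w), j) \<in> R" "to_nat v \<in> verts ?H" "t \<notin> hit" "R = P \<or> R = Q"
    for t w j v R
  proof -
    have "to_nat ((t, w), j) \<in> verts ?H" using that PQ(1) by auto
    then have "to_nat ((t, w), j) \<rightarrow>\<^bsub>?H\<^esub> to_nat v" using that edge by blast
    then show ?thesis using PQ(3)[of "to_nat ((t, w), j)" "to_nat v"] that hitI[of t w j] by auto
  qed
  \<comment> \<open>Each level of the descent from the root passes through the parent port, the
    centre, a child port and the parent port of the child. Liveness keeps the centres in
    \<open>T3\<close>.\<close>
  have live_in: "to_nat (((s, i), u), 1::nat) \<in> R"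
    if i: "i < N" and nh: "(s, i) \<notin> hit" and R: "R = P \<or> R = Q" and root: "root s i \<in> R"
      and u: "u \<in> live h (\<lambda>w. ?L ((s, i), w))" for s i R u
  proof -
    have len: "length u = h" using u by (simp add: live_def)
    have "k \<le> h \<Longrightarrow> to_nat (((s, i), take k u), 1::nat) \<in> R" for k
    proof (induct k)
      case 0
      then show ?case using root by (simp add: root_def)
    next
      case (Suc k)
      let ?x = "((s, i), take k u)"
      define b where "b = u ! k"
      have tk: "take (Suc k) u = take k u @ [b]"
        using Suc len by (simp add: take_Suc_conv_app_nth b_def)
      have x: "?x \<in> nodes" using Suc len i by (simp add: nodes_def short_words_def)
      have alive: "?L ?x \<noteq> 0" using u Suc by (simp add: live_def)
      let ?j = "if b then 2 else 3 :: nat"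
      have "to_nat (?x, 0::nat) \<in> R"
      proof (rule stay[OF _ _ _ nh R])
        show "adj (?x, 1) (?x, 0)" using joined.ray[OF x, of 1] by (simp add: adj_def)
        show "to_nat (?x, 1::nat) \<in> R" using Suc by simp
        show "to_nat (?x, 0::nat) \<in> verts ?H"
          using x alive i by (intro in_T3[OF \<pi>]) (auto simp: V_def)
      qed
      then have "to_nat (?x, ?j) \<in> R"
      proof (rule stay[OF _ _ _ nh R, rotated])
        show "adj (?x, 0) (?x, ?j)" using joined.ray[OF x, of ?j] by (simp add: adj_def)
        show "to_nat (?x, ?j) \<in> verts ?H"
          using x i by (intro in_T3[OF \<pi>]) (auto simp: V_def)
      qed
      then have "to_nat (((s, i), take k u @ [b]), 1::nat) \<in> R"
      proof (rule stay[OF _ _ _ nh R, rotated])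
        show "adj (?x, ?j) (((s, i), take k u @ [b]), 1)"
          using joined.child[OF x, of b] by (simp add: adj_def)
        show "to_nat (((s, i), take k u @ [b]), 1::nat) \<in> verts ?H"
          using Suc len i by (intro in_T3[OF \<pi>]) (auto simp: V_def nodes_def short_words_def)
      qed
      then show ?case by (simp add: tk)
    qed
    from this[of h] show ?thesis using len by simp
  qed
  define clean where "clean = (\<lambda>s R. {i \<in> gd s. (s, i) \<notin> hit \<and> root s i \<in> R})"
  have hit_side: "card {i. (s, i) \<in> hit} \<le> r" "finite {i. (s, i) \<in> hit}" for s
  proof -
    have sub: "Pair s ` {i. (s, i) \<in> hit} \<subseteq> hit" by auto
    then show "finite {i. (s, i) \<in> hit}"
      using fin_hit finite_subset finite_imageD[of "Pair s"] by (metis inj_on_def prod.inject)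
    have "card {i. (s, i) \<in> hit} = card (Pair s ` {i. (s, i) \<in> hit})"
      by (simp add: card_image inj_on_def)
    also have "\<dots> \<le> card hit" using sub fin_hit by (rule card_mono[rotated])
    finally show "card {i. (s, i) \<in> hit} \<le> r" using hit_card by simp
  qed
  have clean_le: "card {i \<in> gd s. root s i \<in> R} \<le> card (clean s R) + r" for s R
  proof -
    have "{i \<in> gd s. root s i \<in> R} \<subseteq> clean s R \<union> {i. (s, i) \<in> hit}" by (auto simp: clean_def)
    then have "card {i \<in> gd s. root s i \<in> R} \<le> card (clean s R \<union> {i. (s, i) \<in> hit})"
      using fin_gd hit_side by (intro card_mono) (auto simp: clean_def)
    also have "\<dots> \<le> card (clean s R) + card {i. (s, i) \<in> hit}" by (rule card_Un_le)
    finally show ?thesis using hit_side(1)[of s] by linarith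
  qed
  have root_Int: "card (root True ` gd True \<inter> R) = card {i \<in> gd True. root True i \<in> R}" for R
  proof -
    have "root True ` gd True \<inter> R = root True ` {i \<in> gd True. root True i \<in> R}" by auto
    then show ?thesis by (simp add: card_image inj_root)
  qed
  have gd8: "8 * r \<le> card (gd s)" for s using many[of s] by (simp add: gd_def)
  have "card (root True ` gd True) = card (gd True)" by (simp add: card_image inj_root)
  then have left: "r \<le> card (clean True P)" "r \<le> card (clean True Q)"
    using PQ(4,5) gd8[of True] clean_le[of True P] clean_le[of True Q] unfolding root_Int by linarith+
  have "gd False \<subseteq> {i \<in> gd False. root False i \<in> P} \<union> {i \<in> gd False. root False i \<in> Q}"
    using root_H PQ(1) by (auto simp: gd_def)
  then have "card (gd False) \<le> card ({i \<in> gd False. root False i \<in> P} \<union> {i \<in> gd False. root False i \<in> Q})"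
    using fin_gd by (intro card_mono) auto
  also have "\<dots> \<le> card {i \<in> gd False. root False i \<in> P} + card {i \<in> gd False. root False i \<in> Q}"
    by (rule card_Un_le)
  finally have right: "r \<le> card (clean False P) \<or> r \<le> card (clean False Q)"
    using gd8[of False] clean_le[of False P] clean_le[of False Q] by linarith
  have contra: False
    if R: "R = P \<and> R' = Q \<or> R = Q \<and> R' = P" and "r \<le> card (clean True R)" "r \<le> card (clean False R')"
    for R R'
  proof -
    have "clean True R \<subseteq> gd True" "clean False R' \<subseteq> gd False" by (auto simp: clean_def)
    with mix that obtain i i' u u' where
      i: "i \<in> clean True R" "i' \<in> clean False R'" "u \<in> live h (\<lambda>w. ?L ((True, i), w))"
        "u' \<in> live h (\<lambda>w. ?L ((False, i'), w))" "\<phi> (i, u) = (i', u')"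
      unfolding mixing_def gd_def by meson
    have iN: "i < N" "(True, i) \<notin> hit" "i' < N" "(False, i') \<notin> hit"
      using i by (auto simp: clean_def gd_def)
    have 1: "to_nat (((True, i), u), 1::nat) \<in> R"
      using i R iN by (intro live_in) (auto simp: clean_def)
    have 2: "to_nat (((False, i'), u'), 1::nat) \<in> R'"
      using i R iN by (intro live_in) (auto simp: clean_def)
    have "adj (((True, i), u), 1) (((False, i'), u'), 1)"
      using joined.leaf[of i u i' u'] i iN by (auto simp: adj_def live_def)
    \<comment> \<open>The matching edge starts in an untouched tree, so its right end stays in
      \<open>R\<close>. That end then lies in the separator, although its tree is untouched
      too.\<close>
    then have "to_nat (((False, i'), u'), 1::nat) \<in> R"
      by (rule stay) (use 1 2 iN R PQ(1) in auto)
    then have "to_nat (((False, i'), u'), 1::nat) \<in> P \<inter> Q" using 2 R by auto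
    then have "(False, i') \<in> hit" by (rule hitI)
    with iN show False by simp
  qed
  from right left contra[of Q P] contra[of P Q] show False by blast
qed

end

section \<open>Random matchings and the main bound\<close>

text \<open>Double counting of the related pairs. It serves to find one matching that suits most
  labellings, given that every labelling suits most matchings.\<close>

lemma ex_card_fibre_le:
  fixes c :: real
  assumes fin: "finite X" "finite Y" and "X \<noteq> {}"
    and le: "\<And>y. y \<in> Y \<Longrightarrow> real (card {x \<in> X. R x y}) \<le> card X * c"
  shows "\<exists>x\<in>X. real (card {y \<in> Y. R x y}) \<le> card Y * c"
proof (rule ccontr)
  assume "\<not> ?thesis"
  then have gt: "card Y * c < real (card {y \<in> Y. R x y})" if "x \<in> X" for x
    using that by (meson not_le)
  have "card X * (card Y * c) = (\<Sum>x\<in>X. card Y * c)" by simp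
  also have "\<dots> < (\<Sum>x\<in>X. real (card {y \<in> Y. R x y}))"
    using fin \<open>X \<noteq> {}\<close> gt by (intro sum_strict_mono) auto
  also have "\<dots> = (\<Sum>x\<in>X. \<Sum>y\<in>Y. if R x y then 1 else 0)"
    using fin by (simp add: sum.If_cases Int_def)
  also have "\<dots> = (\<Sum>y\<in>Y. \<Sum>x\<in>X. if R x y then 1 else 0)"
    by (rule sum.swap)
  also have "\<dots> = (\<Sum>y\<in>Y. real (card {x \<in> X. R x y}))"
    using fin by (simp add: sum.If_cases Int_def)
  also have "\<dots> \<le> (\<Sum>y\<in>Y. card X * c)" using le by (intro sum_mono) auto
  finally show False by (simp add: algebra_simps)
qed

text \<open>For a fixed labelling, a union bound over all pairs of sets of at least \<open>r\<close>
  good trees. If these have \<open>p\<close> and \<open>q\<close> live leaves, the proportion of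
  matchings that join none of them is at most \<open>exp (- p * q / card S)\<close>.\<close>

lemma card_not_mixing:
  assumes N: "N = 256 * r" and r: "r > 0" and h: "(9/8 :: real) ^ h \<ge> 2 ^ 20"
  defines "S \<equiv> {..<N} \<times> {u :: bool list. length u = h}"
  shows "real (card {\<phi>. \<phi> permutes S \<and> \<not> matched_trees.mixing N h \<phi> r L}) \<le> fact (card S) * (1/2) ^ r"
proof -
  define m :: real where "m = (3/2) ^ h"
  define gd where "gd = (\<lambda>s. {i. i < N \<and> good h (\<lambda>w. L ((s, i), w))})"
  define leaves where "leaves = (\<lambda>s A. SIGMA i:A. live h (\<lambda>w. L ((s, i), w)))"
  define \<T> where "\<T> = {(A, B). A \<subseteq> gd True \<and> B \<subseteq> gd False \<and> r \<le> card A \<and> r \<le> card B}"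
  define av where "av = (\<lambda>(A, B). {\<phi>. \<phi> permutes S \<and> \<phi> ` leaves True A \<inter> leaves False B = {}})"
  have finS: "finite S" by (simp add: S_def finite_words)
  have cardS: "card S = 256 * r * 2 ^ h" by (simp add: S_def card_cartesian_product card_words N)
  then have cardS_pos: "card S > 0" using r by simp
  have gd_sub: "gd s \<subseteq> {..<N}" for s by (auto simp: gd_def)
  have \<T>_sub: "\<T> \<subseteq> Pow {..<N} \<times> Pow {..<N}" using gd_sub by (fastforce simp: \<T>_def)
  then have fin\<T>: "finite \<T>" by (rule finite_subset) auto
  have "card \<T> \<le> card (Pow {..<N} \<times> Pow {..<N})" using \<T>_sub by (intro card_mono) auto
  \<comment> \<open>There are \<open>2 ^ N\<close> sets on either side, with
    \<open>N = 256 * r\<close>.\<close>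
  also have "\<dots> = 2 ^ (512 * r)"
    by (simp add: card_cartesian_product card_Pow N flip: power_add)
  finally have card\<T>: "real (card \<T>) \<le> 2 ^ (512 * r)"
    by (metis of_nat_le_iff of_nat_numeral of_nat_power)
  have leaves_sub: "leaves s A \<subseteq> S" if "A \<subseteq> gd s" for s A
    using that gd_sub by (fastforce simp: leaves_def S_def live_def)
  have card_leaves: "real r * m / 2 \<le> card (leaves s A)" if A: "A \<subseteq> gd s" "r \<le> card A" for s A
  proof -
    have finA: "finite A" using A gd_sub[of s] by (meson finite_lessThan finite_subset)
    have "real r * (m / 2) \<le> real (card A) * (m / 2)"
      using A by (intro mult_right_mono) (auto simp: m_def)
    also have "\<dots> = (\<Sum>i\<in>A. m / 2)" by simp
    also have "\<dots> \<le> (\<Sum>i\<in>A. real (card (live h (\<lambda>w. L ((s, i), w)))))"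
      using A by (intro sum_mono) (auto simp: gd_def good_def m_def)
    also have "\<dots> = card (leaves s A)"
      unfolding leaves_def using finA finite_live by (subst card_SigmaI) auto
    finally show ?thesis by simp
  qed
  have avoid: "real (card (av AB)) \<le> fact (card S) * (1/2) ^ (1024 * r)" if "AB \<in> \<T>" for AB
  proof -
    obtain A B where AB: "AB = (A, B)" "A \<subseteq> gd True" "B \<subseteq> gd False" "r \<le> card A" "r \<le> card B"
      using \<open>AB \<in> \<T>\<close> by (auto simp: \<T>_def)
    define p where "p = real (card (leaves True A))"
    define q where "q = real (card (leaves False B))"
    have pq: "real r * m / 2 \<le> p" "real r * m / 2 \<le> q"
      using card_leaves AB by (auto simp: p_def q_def)
    have m0: "0 \<le> real r * m / 2" by (simp add: m_def)
    have "card (leaves False B) \<le> card S" using leaves_sub AB finS by (intro card_mono) auto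
    then have qS: "q / card S \<le> 1" using cardS_pos by (simp add: q_def divide_le_eq)
    have "(real r * m / 2) * (real r * m / 2) \<le> p * q"
      using pq m0 by (intro mult_mono) auto
    \<comment> \<open>As \<open>(3/2)^2 = 2 * (9/8)\<close>, the factor \<open>2 ^ h\<close> is
      absorbed by \<open>card S\<close> and \<open>(9/8) ^ h\<close> remains.\<close>
    moreover have "(real r * m / 2) * (real r * m / 2) = card S * (r * (9/8) ^ h / 1024)"
    proof -
      have "m * m = (9/8) ^ h * 2 ^ h" by (simp add: m_def flip: power_mult_distrib)
      moreover have "(real r * m / 2) * (real r * m / 2) = real r * real r * (m * m) / 4"
        by (simp add: algebra_simps)
      ultimately show ?thesis by (simp add: cardS)
    qed
    \<comment> \<open>Since \<open>2 ^ 20 = 1024 * 1024\<close>, one factor pays for the denominator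
      and the other leaves the exponent \<open>1024 * r\<close>, twice that in the number of
      pairs.\<close>
    moreover have "real r * 1024 \<le> r * (9/8) ^ h / 1024"
      using mult_left_mono[OF h, of "real r"] by simp
    then have "card S * (real r * 1024) \<le> card S * (r * (9/8) ^ h / 1024)"
      by (intro mult_left_mono) auto
    ultimately have "card S * (real r * 1024) \<le> p * q" by linarith
    then have "real r * 1024 \<le> p * q / card S"
      using cardS_pos by (subst pos_le_divide_eq) (auto simp: mult.commute)
    then have big: "real (1024 * r) \<le> q / card S * p" by (simp add: mult.commute)
    have "real (card (av AB)) \<le> fact (card S) * (1 - q / card S) ^ card (leaves True A)"
      unfolding AB av_def q_def prod.case
      using finS leaves_sub AB by (intro card_permutes_avoiding) auto
    also have "(1 - q / card S) ^ card (leaves True A) \<le> exp (- (q / card S)) ^ card (leaves True A)"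
      using qS exp_ge_add_one_self[of "- (q / card S)"] by (intro power_mono) auto
    also have "\<dots> = exp (- (q / card S * p))"
      by (simp add: p_def exp_of_nat_mult[symmetric] mult.commute)
    also have "\<dots> \<le> exp (- real (1024 * r))" using big by simp
    also have "\<dots> = exp (- 1) ^ (1024 * r)" by (simp flip: exp_of_nat_mult)
    also have "\<dots> \<le> (1/2) ^ (1024 * r)"
    proof (rule power_mono)
      have "2 \<le> exp (1 :: real)" using exp_ge_add_one_self[of 1] by simp
      then show "exp (- 1) \<le> (1/2 :: real)" by (simp add: exp_minus field_simps)
    qed simp
    finally show ?thesis by (simp add: mult_left_mono)
  qed
  have "{\<phi>. \<phi> permutes S \<and> \<not> matched_trees.mixing N h \<phi> r L} \<subseteq> (\<Union>AB\<in>\<T>. av AB)"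
  proof clarify
    fix \<phi> assume \<phi>: "\<phi> permutes S" "\<not> matched_trees.mixing N h \<phi> r L"
    then have "\<exists>A B. (A, B) \<in> \<T> \<and> (\<forall>i\<in>A. \<forall>i'\<in>B. \<forall>u\<in>live h (\<lambda>w. L ((True, i), w)).
        \<forall>u'\<in>live h (\<lambda>w. L ((False, i'), w)). \<phi> (i, u) \<noteq> (i', u'))"
      unfolding S_def \<T>_def gd_def by (subst (asm) matched_trees.mixing_def) (unfold matched_trees_def, auto)
    then obtain A B where AB: "(A, B) \<in> \<T>" "\<And>i i' u u'. i \<in> A \<Longrightarrow> i' \<in> B \<Longrightarrow>
        u \<in> live h (\<lambda>w. L ((True, i), w)) \<Longrightarrow> u' \<in> live h (\<lambda>w. L ((False, i'), w)) \<Longrightarrow> \<phi> (i, u) \<noteq> (i', u')"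
      by blast
    have "\<phi> \<in> av (A, B)"
      using \<phi>(1) AB(2) by (fastforce simp: av_def leaves_def)
    with AB(1) show "\<phi> \<in> (\<Union>AB\<in>\<T>. av AB)" by blast
  qed
  moreover have fin_av: "finite (av AB)" for AB
    by (rule finite_subset[OF _ finite_permutations[OF finS]]) (auto simp: av_def split: prod.split)
  ultimately have "card {\<phi>. \<phi> permutes S \<and> \<not> matched_trees.mixing N h \<phi> r L} \<le> card (\<Union>AB\<in>\<T>. av AB)"
    using fin\<T> by (intro card_mono) auto
  also have "\<dots> \<le> (\<Sum>AB\<in>\<T>. card (av AB))" using fin\<T> by (rule card_UN_le)
  finally have "real (card {\<phi>. \<phi> permutes S \<and> \<not> matched_trees.mixing N h \<phi> r L})
      \<le> real (\<Sum>AB\<in>\<T>. card (av AB))"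
    by (rule of_nat_mono)
  also have "\<dots> = (\<Sum>AB\<in>\<T>. real (card (av AB)))" by (rule of_nat_sum)
  also have "\<dots> \<le> (\<Sum>AB\<in>\<T>. fact (card S) * (1/2) ^ (1024 * r))"
    using avoid by (rule sum_mono)
  also have "\<dots> = fact (card S) * (real (card \<T>) * (1/2) ^ (1024 * r))" by simp
  also have "\<dots> \<le> fact (card S) * (2 ^ (512 * r) * (1/2) ^ (1024 * r))"
    using card\<T> by (intro mult_left_mono mult_right_mono) auto
  also have "2 ^ (512 * r) * (1/2) ^ (1024 * r) = (1/2 :: real) ^ (512 * r)"
  proof -
    have "(1/2 :: real) ^ (1024 * r) = (1/2) ^ (512 * r) * (1/2) ^ (512 * r)"
      by (simp flip: power_add)
    moreover have "2 ^ (512 * r) * (1/2 :: real) ^ (512 * r) = 1"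
      by (simp flip: power_mult_distrib)
    ultimately show ?thesis by simp
  qed
  also have "(1/2 :: real) ^ (512 * r) \<le> (1/2) ^ r" by (rule power_decreasing) auto
  finally show ?thesis by (simp add: mult_left_mono)
qed

section \<open>The probability bound and the number of vertices\<close>

context matched_trees
begin

text \<open>Under uniform labels each of three bad events, too few good trees on the left, too few
  on the right, and failure of mixing, has probability at most \<open>(1/2) ^ r\<close>.\<close>

lemma prob_treewidth_T3_ge:
  assumes N: "N = 256 * r"
    and mix: "real (card {L \<in> nodes \<rightarrow>\<^sub>E {..<4}. \<not> mixing r L}) \<le> 4 ^ card nodes * (1/2) ^ r"
  shows "measure_pmf.prob (random_ordering graph_of) {\<pi>. r \<le> treewidth (T3 graph_of \<pi>)} \<ge> 1 - 3 * (1/2) ^ r"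
proof -
  let ?E = "nodes \<rightarrow>\<^sub>E {..<4::nat}" and ?p = "measure_pmf.prob (random_ordering graph_of)"
  \<comment> \<open>\<open>N = 256 * r\<close> is 32 times the threshold \<open>8 * r\<close>, as
    the tail bound for good trees requires.\<close>
  define few where "few = (\<lambda>s. {L \<in> ?E. card {j \<in> {s} \<times> {..<N}. good h (\<lambda>w. L (j, w))} \<le> 8 * r})"
  define bad where "bad = few True \<union> few False \<union> {L \<in> ?E. \<not> mixing r L}"
  have few: "real (card (few s)) \<le> 4 ^ card nodes * (1/2) ^ r" for s
  proof -
    have "real (card (few s)) \<le> 4 ^ card nodes * (1/2) ^ (8 * r)"
      unfolding few_def nodes_def by (rule card_few_good) (auto simp: N card_cartesian_product)
    also have "\<dots> \<le> 4 ^ card nodes * (1/2) ^ r"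
      by (intro mult_left_mono power_decreasing) auto
    finally show ?thesis .
  qed
  have "card bad \<le> card (few True) + card (few False) + card {L \<in> ?E. \<not> mixing r L}"
    unfolding bad_def by (meson add_le_mono1 card_Un_le order_trans)
  then have card_bad: "real (card bad) \<le> 4 ^ card nodes * (3 * (1/2) ^ r)"
    using few[of True] few[of False] mix by linarith
  have st: "inj_on to_nat (nodes \<times> {..<4::nat})" by (simp add: inj_on_def)
  have finV: "finite (verts graph_of)" by (simp add: verts_graph_of finite_V)
  have "?p {\<pi>. label \<pi> \<in> bad} = real (card bad) / 4 ^ card nodes"
    unfolding random_ordering_def using st to_nat_nodes_subset finV finite_nodes
    by (intro prob_last_label) (auto simp: bad_def few_def)
  also have "\<dots> \<le> 3 * (1/2) ^ r" using card_bad by (simp add: field_simps)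
  finally have "?p {\<pi>. label \<pi> \<in> bad} \<le> 3 * (1/2) ^ r" .
  moreover have "1 - ?p {\<pi>. label \<pi> \<in> bad} = ?p (- {\<pi>. label \<pi> \<in> bad})"
    using measure_pmf.prob_compl[of "{\<pi>. label \<pi> \<in> bad}" "random_ordering graph_of"]
    by (simp add: Compl_eq_Diff_UNIV)
  moreover have "?p (- {\<pi>. label \<pi> \<in> bad}) \<le> ?p {\<pi>. r \<le> treewidth (T3 graph_of \<pi>)}"
  proof (rule measure_pmf.finite_measure_mono_AE)
    show "AE \<pi> in random_ordering graph_of. \<pi> \<in> - {\<pi>. label \<pi> \<in> bad} \<longrightarrow>
        \<pi> \<in> {\<pi>. r \<le> treewidth (T3 graph_of \<pi>)}"
    proof (intro AE_pmfI impI)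
      fix \<pi> assume "\<pi> \<in> set_pmf (random_ordering graph_of)" and nb: "\<pi> \<in> - {\<pi>. label \<pi> \<in> bad}"
      then have \<pi>: "\<pi> \<in> permutations_of_set (verts graph_of)"
        using finV by (simp add: random_ordering_def)
      have E: "label \<pi> \<in> ?E"
        using last_label_in_PiE[OF st to_nat_nodes_subset \<pi>] .
      have "8 * r \<le> card {i. i < N \<and> good h (\<lambda>w. label \<pi> ((s, i), w))}" for s
      proof -
        have "label \<pi> \<notin> few s" using nb by (cases s) (auto simp: bad_def)
        then have "8 * r \<le> card {j \<in> {s} \<times> {..<N}. good h (\<lambda>w. label \<pi> (j, w))}"
          using E by (simp add: few_def)
        also have "{j \<in> {s} \<times> {..<N}. good h (\<lambda>w. label \<pi> (j, w))}
          = Pair s ` {i. i < N \<and> good h (\<lambda>w. label \<pi> ((s, i), w))}" by auto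
        finally show ?thesis by (simp add: card_image inj_on_def)
      qed
      moreover have "mixing r (label \<pi>)" using nb E by (simp add: bad_def)
      ultimately show "\<pi> \<in> {\<pi>. r \<le> treewidth (T3 graph_of \<pi>)}"
        using treewidth_T3_ge[OF \<pi>] by simp
    qed
  qed simp
  ultimately show ?thesis by linarith
qed

lemma card_verts_graph_of: "card (verts graph_of) = card V"
  by (simp add: verts_graph_of card_image inj_on_def)

text \<open>Four vertices are allowed even for a leaf; for fixed \<open>h\<close> and
  \<open>d\<close> the bound is still linear in \<open>N\<close>.\<close>

lemma card_verts_le: "card (verts graph_of) \<le> 8 * N * card (short_words (Suc h)) + Suc d"
proof -
  have "card V \<le> card ((((UNIV :: bool set) \<times> {..<N}) \<times> short_words (Suc h)) \<times> {..<4::nat}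
      \<union> {((True, N), [] :: bool list)} \<times> {..d})"
    by (rule card_mono) (auto simp: V_def nodes_def short_words_def finite_short_words[unfolded short_words_def])
  also have "\<dots> \<le> card ((((UNIV :: bool set) \<times> {..<N}) \<times> short_words (Suc h)) \<times> {..<4::nat})
      + card ({((True, N), [] :: bool list)} \<times> {..d})" by (rule card_Un_le)
  also have "\<dots> = 8 * N * card (short_words (Suc h)) + Suc d"
    by (simp add: card_cartesian_product card_UNIV_bool)
  finally show ?thesis by (simp add: card_verts_graph_of)
qed

text \<open>The parent ports of the roots on the left are \<open>N\<close> distinct vertices, also
  for \<open>h = 0\<close>, when the roots are leaves.\<close>

lemma card_verts_ge: "N \<le> card (verts graph_of)"
proof -
  have "(\<lambda>i. (((True, i), []), 1)) ` {..<N} \<subseteq> V" by (auto simp: V_def nodes_def short_words_def)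
  then have "card ((\<lambda>i. (((True, i), [] :: bool list), 1::nat)) ` {..<N}) \<le> card V"
    using finite_V by (rule card_mono[rotated])
  then show ?thesis by (simp add: card_verts_graph_of card_image inj_on_def)
qed

end

text \<open>The matching has to be fixed before the ordering is drawn. Averaging turns the bound
  over matchings for each labelling into a bound over labellings for a single matching.\<close>

lemma ex_mixing_matching:
  assumes "N = 256 * r" "r > 0" "(9/8 :: real) ^ h \<ge> 2 ^ 20"
  shows "\<exists>\<phi>. \<phi> permutes {..<N} \<times> {u :: bool list. length u = h} \<and>
    real (card {L \<in> (UNIV \<times> {..<N}) \<times> short_words h \<rightarrow>\<^sub>E {..<4}. \<not> matched_trees.mixing N h \<phi> r L})
      \<le> 4 ^ card (((UNIV :: bool set) \<times> {..<N}) \<times> short_words h) * (1/2) ^ r"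
proof -
  let ?S = "{..<N} \<times> {u :: bool list. length u = h}"
  let ?I = "((UNIV :: bool set) \<times> {..<N}) \<times> short_words h"
  have finS: "finite ?S" by (simp add: finite_words)
  have finI: "finite ?I" by (simp add: finite_short_words)
  have "\<exists>\<phi>\<in>{\<phi>. \<phi> permutes ?S}. real (card {L \<in> ?I \<rightarrow>\<^sub>E {..<4}. \<not> matched_trees.mixing N h \<phi> r L})
      \<le> card (?I \<rightarrow>\<^sub>E {..<4::nat}) * (1/2) ^ r"
  proof (rule ex_card_fibre_le)
    show "finite {\<phi>. \<phi> permutes ?S}" using finS by (rule finite_permutations)
    show "{\<phi>. \<phi> permutes ?S} \<noteq> {}" using permutes_id by blast
    show "finite (?I \<rightarrow>\<^sub>E {..<4::nat})" using finI by (intro finite_PiE) auto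
    fix L :: "node \<Rightarrow> nat"
    show "real (card {\<phi> \<in> {\<phi>. \<phi> permutes ?S}. \<not> matched_trees.mixing N h \<phi> r L})
        \<le> card {\<phi>. \<phi> permutes ?S} * (1/2) ^ r"
      using card_not_mixing[OF assms, of L] finS by (simp add: card_permutations)
  qed
  then show ?thesis using finI by (simp add: card_PiE card_cartesian_product mult.assoc)
qed

theorem theorem3p2:
  fixes d :: nat
  assumes "d > 2"
  shows "\<exists>(c::real) (G :: nat \<Rightarrow> (nat, nat \<times> nat) pre_digraph).
    c > 0 \<and>
    (\<forall>k. graph (G k) \<and> max_degree (G k) = d) \<and>
    filterlim (\<lambda>k. card (verts (G k))) at_top sequentially \<and>
    (\<lambda>k. measure_pmf.prob (random_ordering (G k))
           {\<pi>. real (treewidth (T3 (G k) \<pi>)) \<ge> c * real (card (verts (G k)))})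
      \<longlonglongrightarrow> 1"
proof -
  \<comment> \<open>The depth is fixed independently of \<open>k\<close>, so all trees have constant
    size.\<close>
  obtain h where h: "(2 :: real) ^ 20 < (9/8) ^ h" using real_arch_pow[of "9/8"] by auto
  \<comment> \<open>\<open>Suc k\<close> takes the place of \<open>r\<close>, which has to be
    positive.\<close>
  define N where "N = (\<lambda>k. 256 * Suc k)"
  define K where "K = card (short_words (Suc h))"
  have "\<forall>k. \<exists>\<phi>. \<phi> permutes {..<N k} \<times> {u :: bool list. length u = h} \<and>
    real (card {L \<in> (UNIV \<times> {..<N k}) \<times> short_words h \<rightarrow>\<^sub>E {..<4}.
      \<not> matched_trees.mixing (N k) h \<phi> (Suc k) L})
      \<le> 4 ^ card (((UNIV :: bool set) \<times> {..<N k}) \<times> short_words h) * (1/2) ^ Suc k"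
    using h by (intro allI ex_mixing_matching) (auto simp: N_def)
  from choice[OF this] obtain \<phi> where "\<forall>k. \<phi> k permutes {..<N k} \<times> {u :: bool list. length u = h} \<and>
    real (card {L \<in> (UNIV \<times> {..<N k}) \<times> short_words h \<rightarrow>\<^sub>E {..<4}.
      \<not> matched_trees.mixing (N k) h (\<phi> k) (Suc k) L})
      \<le> 4 ^ card (((UNIV :: bool set) \<times> {..<N k}) \<times> short_words h) * (1/2) ^ Suc k" ..
  then have \<phi>: "\<And>k. \<phi> k permutes {..<N k} \<times> {u :: bool list. length u = h}"
    "\<And>k. real (card {L \<in> (UNIV \<times> {..<N k}) \<times> short_words h \<rightarrow>\<^sub>E {..<4}.
      \<not> matched_trees.mixing (N k) h (\<phi> k) (Suc k) L})
      \<le> 4 ^ card (((UNIV :: bool set) \<times> {..<N k}) \<times> short_words h) * (1/2) ^ Suc k"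
    by blast+
  have mt: "matched_trees (N k) h d (\<phi> k)" for k
    using \<phi>(1) assms by unfold_locales auto
  define G where "G = (\<lambda>k. matched_trees.graph_of (N k) h d (\<phi> k))"
  \<comment> \<open>\<open>2048 = 8 * 256\<close> comes from \<open>8 * N k\<close> with
    \<open>N k = 256 * Suc k\<close>; the additional star is absorbed by
    \<open>Suc d \<le> Suc k * Suc d\<close>.\<close>
  define c :: real where "c = 1 / (2048 * K + Suc d)"
  have c: "c > 0" by (simp add: c_def)
  have size: "c * card (verts (G k)) \<le> Suc k" for k
  proof -
    have "card (verts (G k)) \<le> 8 * N k * K + Suc d"
      using matched_trees.card_verts_le[OF mt] by (simp add: G_def K_def)
    also have "\<dots> \<le> Suc k * (2048 * K + Suc d)" by (simp add: N_def algebra_simps)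
    finally have "real (card (verts (G k))) \<le> Suc k * (2048 * K + Suc d)"
      by (metis of_nat_le_iff)
    then show ?thesis by (simp add: c_def field_simps)
  qed
  have prob: "1 - 3 * (1/2) ^ Suc k \<le> measure_pmf.prob (random_ordering (G k))
      {\<pi>. real (treewidth (T3 (G k) \<pi>)) \<ge> c * real (card (verts (G k)))}" for k
  proof -
    interpret matched_trees "N k" h d "\<phi> k" by (rule mt)
    have "1 - 3 * (1/2) ^ Suc k \<le> measure_pmf.prob (random_ordering (G k)) {\<pi>. Suc k \<le> treewidth (T3 (G k) \<pi>)}"
      unfolding G_def by (rule prob_treewidth_T3_ge) (simp add: N_def, unfold nodes_def, rule \<phi>(2))
    also have "\<dots> \<le> measure_pmf.prob (random_ordering (G k))
        {\<pi>. real (treewidth (T3 (G k) \<pi>)) \<ge> c * real (card (verts (G k)))}"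
      using size[of k] by (intro measure_pmf.finite_measure_mono) (auto intro: order_trans)
    finally show ?thesis .
  qed
  have "filterlim (\<lambda>k. card (verts (G k))) at_top sequentially"
  proof (rule filterlim_at_top_mono[OF filterlim_ident])
    have "k \<le> card (verts (G k))" for k
      using matched_trees.card_verts_ge[OF mt, of k] by (simp add: G_def N_def)
    then show "eventually (\<lambda>k. k \<le> card (verts (G k))) sequentially" by simp
  qed
  moreover have "(\<lambda>k. measure_pmf.prob (random_ordering (G k))
      {\<pi>. real (treewidth (T3 (G k) \<pi>)) \<ge> c * real (card (verts (G k)))}) \<longlonglongrightarrow> 1"
  proof (rule tendsto_sandwich)
    have "(\<lambda>k. (1/2 :: real) ^ Suc k) \<longlonglongrightarrow> 0"
      by (intro LIMSEQ_Suc LIMSEQ_realpow_zero) auto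
    then have "(\<lambda>k. 1 - 3 * (1/2 :: real) ^ Suc k) \<longlonglongrightarrow> 1 - 3 * 0"
      by (intro tendsto_intros)
    then show "(\<lambda>k. 1 - 3 * (1/2 :: real) ^ Suc k) \<longlonglongrightarrow> 1" by simp
  qed (use prob in auto)
  moreover have "graph (G k) \<and> max_degree (G k) = d" for k
    using matched_trees.graph_graph_of[OF mt] matched_trees.max_degree_graph_of[OF mt] by (simp add: G_def)
  ultimately show ?thesis using c by blast
qed

end
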